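(* For every regular polytope $\mathcal{P}$ and all integers $k\le r$, the $(k,r)$-incidence graph of $\mathcal{P}$ is weakly norming.
   Context: Let $\mathcal{P}$ be a regular polytope. For integers $k\le r$, the $(k,r)$-incidence graph of $\mathcal{P}$ is the bipartite graph whose two parts are the set of $k$-faces and the set of $r$-faces of $\mathcal{P}$, with a $k$-face and an $r$-face adjacent if and only if one contains the other. For a bipartite graph $H$ with a fixed bipartition $(A,B)$ and a bounded measurable $f:[0,1]^2\to\mathbb{R}$, set $\|f\|_{r(H)}:=\left(\int \prod_{ij\in E(H),\, i\in A,\, j\in B}|f(x_i,x_j)|\,d\mu^{|V(H)|}\right)^{1/|E(H)|}$, where $\mu$ is Lebesgue measure on $[0,1]$ and there is one variable $x_v\in[0,1]$ per vertex $v$. $H$ is called weakly norming if $\|\cdot\|_{r(H)}$ is a norm on the space of bounded measurable functions $[0,1]^2\to\mathbb{R}$. *)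

theory Defs
  imports "HOL-Analysis.Analysis"
begin

section \<open>Regular polytopes and their incidence graphs\<close>

text \<open>
  A polytope need not span its ambient space. Every isometry of its affine hull extends to the
  ambient space, so the ambient symmetries induce the full symmetry group of the polytope.
\<close>

definition symmetry_of :: "('a::euclidean_space \<Rightarrow> 'a) \<Rightarrow> 'a set \<Rightarrow> bool" where
  "symmetry_of g P \<longleftrightarrow> (\<forall>x y. dist (g x) (g y) = dist x y) \<and> g ` P = P"

text \<open>The improper faces, the empty set and \<open>P\<close> itself, belong to every flag.\<close>

definition flag_of :: "'a::euclidean_space set set \<Rightarrow> 'a set \<Rightarrow> bool" where
  "flag_of C P \<longleftrightarrow> subset.maxchain {F. F face_of P} C"

definition regular_polytope :: "'a::euclidean_space set \<Rightarrow> bool" where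
  "regular_polytope P \<longleftrightarrow> polytope P \<and>
     (\<forall>C D. flag_of C P \<longrightarrow> flag_of D P \<longrightarrow> (\<exists>g. symmetry_of g P \<and> (\<lambda>F. g ` F) ` C = D))"

text \<open>\<open>aff_dim\<close> is \<open>-1\<close> exactly for the empty face.\<close>

definition faces_of_dim :: "int \<Rightarrow> 'a::euclidean_space set \<Rightarrow> 'a set set" where
  "faces_of_dim k P = {F. F face_of P \<and> aff_dim F = k}"

definition incidence_edges ::
  "int \<Rightarrow> int \<Rightarrow> 'a::euclidean_space set \<Rightarrow> ('a set \<times> 'a set) set" where
  "incidence_edges k r P =
     {(F, G). F \<in> faces_of_dim k P \<and> G \<in> faces_of_dim r P \<and> (F \<subseteq> G \<or> G \<subseteq> F)}"

section \<open>Weakly norming bipartite graphs\<close>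

text \<open>
  A bipartite graph is given by its parts \<open>A\<close>, \<open>B\<close> and its edges \<open>E \<subseteq> A \<times> B\<close>. Its vertex set is the
  disjoint sum \<open>A <+> B\<close>, so the two parts are always distinct, even if \<open>A = B\<close> as sets.
\<close>

abbreviation unit_square :: "(real \<times> real) set" where
  "unit_square \<equiv> {0..1} \<times> {0..1}"

text \<open>Values outside the unit square are irrelevant throughout.\<close>

definition bounded_measurable :: "(real \<times> real \<Rightarrow> real) set" where
  "bounded_measurable =
     {f. f \<in> borel_measurable (lebesgue_on unit_square) \<and> bounded (f ` unit_square)}"

text \<open>
  The product measure is completed because, for a Lebesgue measurable \<open>f\<close>, the integrand is in
  general measurable only with respect to the completed product sigma-algebra.
\<close>

definition graph_norm ::
  "'a set \<Rightarrow> 'b set \<Rightarrow> ('a \<times> 'b) set \<Rightarrow> (real \<times> real \<Rightarrow> real) \<Rightarrow> real" where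
  "graph_norm A B E f =
     (\<integral>x. (\<Prod>(a, b)\<in>E. \<bar>f (x (Inl a), x (Inr b))\<bar>)
        \<partial>completion (Pi\<^sub>M (A <+> B) (\<lambda>_. lebesgue_on {0..1}))) powr (1 / real (card E))"

text \<open>As usual, functions that agree almost everywhere are identified.\<close>

definition norm_on_bounded_measurable :: "((real \<times> real \<Rightarrow> real) \<Rightarrow> real) \<Rightarrow> bool" where
  "norm_on_bounded_measurable N \<longleftrightarrow>
     (\<forall>f\<in>bounded_measurable. 0 \<le> N f) \<and>
     (\<forall>f\<in>bounded_measurable. N f = 0 \<longleftrightarrow> (AE p in lebesgue_on unit_square. f p = 0)) \<and>
     (\<forall>c. \<forall>f\<in>bounded_measurable. N (\<lambda>p. c * f p) = \<bar>c\<bar> * N f) \<and>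
     (\<forall>f\<in>bounded_measurable. \<forall>g\<in>bounded_measurable. N (\<lambda>p. f p + g p) \<le> N f + N g)"

definition weakly_norming :: "'a set \<Rightarrow> 'b set \<Rightarrow> ('a \<times> 'b) set \<Rightarrow> bool" where
  "weakly_norming A B E \<longleftrightarrow> norm_on_bounded_measurable (graph_norm A B E)"

end

theory Submission
  imports Defs "HOL-Probability.Infinite_Product_Measure"
begin

text \<open>
  Reflections in the mirrors of a regular polytope act on its incidence graph, and every edge lies
  (weakly) on one side of each mirror. Cauchy--Schwarz across a mirror therefore bounds the square of
  an integral of a product of functions attached to the edges by the product of the integrals for the
  two reflected colourings of the edges. Among the colourings by two functions, the maximizers are
  closed under these foldings, and suitable foldings towards a generic point near the barycentre of a
  fixed flag contract all edges to a single one; so a monochromatic colouring is a maximizer, and the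
  triangle inequality follows by expanding \<open>\<Prod>(\<bar>f\<bar> + \<bar>g\<bar>)\<close>.

  An edge other than the base edge is separated from the base point by a mirror: take a flag through
  the edge whose chamber point is nearest to the base point. If no wall of this flag separates
  it from the base point, then the base point lies in the cone of the flag, and uniqueness of carriers
  in the barycentric subdivision makes it the base flag; a separating wall that fixes the edge would
  lead to a nearer flag.
\<close>

section \<open>Cauchy--Schwarz across a reflection\<close>

text \<open>Regularity is given as transitivity on flags, with no reflection in sight. Reflections
  are recovered from neighbouring flags that differ in a single face: a symmetry taking one to the
  other fixes the centroids of all common faces and moves one more centroid, and the directions from
  the centre to these centroids span the polytope, so on the polytope it agrees with a reflection.
  Foldings have no prescribed order. They terminate because one point serves all mirrors at once:
  the squared distance from the midpoint of an edge to that point drops under each folding that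
  moves the edge. Foldings act on edges while the extremal problem is about colourings, which are
  pulled back. The colour that survives cannot be predicted, so only the maximum of the two
  monochromatic values is available as a bound. Normalizing both functions beforehand makes this
  maximum at most 1, which is enough for the triangle inequality; playing a function off against the
  constant 1 gives definiteness.\<close>

definition depends_only_on :: "'v set \<Rightarrow> (('v \<Rightarrow> 'm) \<Rightarrow> 'c) \<Rightarrow> bool" where
  "depends_only_on U f \<longleftrightarrow> (\<forall>x y. (\<forall>v\<in>U. x v = y v) \<longrightarrow> f x = f y)"

lemma depends_only_onD:
  "depends_only_on U f \<Longrightarrow> (\<And>v. v \<in> U \<Longrightarrow> x v = y v) \<Longrightarrow> f x = f y"
  by (auto simp: depends_only_on_def)

lemma depends_only_onI:
  "(\<And>x y. (\<And>v. v \<in> U \<Longrightarrow> x v = y v) \<Longrightarrow> f x = f y) \<Longrightarrow> depends_only_on U f"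
  unfolding depends_only_on_def by blast

text \<open>Given the coordinates \<open>Z\<close> on the cut, the coordinates \<open>L\<close> and
  \<open>R\<close> on its two sides are independent, so Fubini turns the joint integral over the two
  sides into a product. Only the sign of \<open>\<sigma>\<close> matters.\<close>

lemma nn_integral_PiM_conditionally_independent:
  fixes M :: "'m measure" and \<sigma> :: "'v \<Rightarrow> real" and h a b :: "('v \<Rightarrow> 'm) \<Rightarrow> ennreal"
  assumes M: "sigma_finite_measure M" and V: "finite V"
    and h: "h \<in> borel_measurable (Pi\<^sub>M {v \<in> V. \<sigma> v = 0} (\<lambda>_. M))"
    and a: "a \<in> borel_measurable (Pi\<^sub>M {v \<in> V. 0 \<le> \<sigma> v} (\<lambda>_. M))"
    and b: "b \<in> borel_measurable (Pi\<^sub>M {v \<in> V. \<sigma> v \<le> 0} (\<lambda>_. M))"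
    and h': "depends_only_on {v \<in> V. \<sigma> v = 0} h"
    and a': "depends_only_on {v \<in> V. 0 \<le> \<sigma> v} a"
    and b': "depends_only_on {v \<in> V. \<sigma> v \<le> 0} b"
  defines "Z \<equiv> {v \<in> V. \<sigma> v = 0}" and "L \<equiv> {v \<in> V. 0 < \<sigma> v}" and "R \<equiv> {v \<in> V. \<sigma> v < 0}"
  shows "(\<integral>\<^sup>+x. h x * (a x * b x) \<partial>Pi\<^sub>M V (\<lambda>_. M)) =
    (\<integral>\<^sup>+z. h z * ((\<integral>\<^sup>+l. a (merge Z L (z, l)) \<partial>Pi\<^sub>M L (\<lambda>_. M)) *
      (\<integral>\<^sup>+r. b (merge Z R (z, r)) \<partial>Pi\<^sub>M R (\<lambda>_. M))) \<partial>Pi\<^sub>M Z (\<lambda>_. M))"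
    and "(\<lambda>z. \<integral>\<^sup>+l. a (merge Z L (z, l)) \<partial>Pi\<^sub>M L (\<lambda>_. M)) \<in> borel_measurable (Pi\<^sub>M Z (\<lambda>_. M))"
    and "(\<lambda>z. \<integral>\<^sup>+r. b (merge Z R (z, r)) \<partial>Pi\<^sub>M R (\<lambda>_. M)) \<in> borel_measurable (Pi\<^sub>M Z (\<lambda>_. M))"
proof -
  interpret M: sigma_finite_measure M by fact
  interpret product_sigma_finite "\<lambda>_::'v. M" by standard
  have fin: "finite Z" "finite L" "finite R" using V by (auto simp: Z_def L_def R_def)
  interpret L: finite_product_sigma_finite "\<lambda>_::'v. M" L by standard fact
  interpret R: finite_product_sigma_finite "\<lambda>_::'v. M" R by standard fact
  have VZ: "V = Z \<union> (L \<union> R)" and ZL: "{v \<in> V. 0 \<le> \<sigma> v} = Z \<union> L" and ZR: "{v \<in> V. \<sigma> v \<le> 0} = Z \<union> R"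
    by (auto simp: Z_def L_def R_def)
  have disj: "Z \<inter> (L \<union> R) = {}" "L \<inter> R = {}"
    by (auto simp: Z_def L_def R_def)
  have h_m[measurable]: "h \<in> borel_measurable (Pi\<^sub>M Z (\<lambda>_. M))" using h by (simp add: Z_def)
  have a_m[measurable]: "a \<in> borel_measurable (Pi\<^sub>M (Z \<union> L) (\<lambda>_. M))" using a by (simp add: ZL)
  have b_m[measurable]: "b \<in> borel_measurable (Pi\<^sub>M (Z \<union> R) (\<lambda>_. M))" using b by (simp add: ZR)
  have am2[measurable]: "(\<lambda>p. a (merge Z L p)) \<in> borel_measurable (Pi\<^sub>M Z (\<lambda>_. M) \<Otimes>\<^sub>M Pi\<^sub>M L (\<lambda>_. M))"
    by (rule measurable_compose[OF measurable_merge a_m])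
  have bm2[measurable]: "(\<lambda>p. b (merge Z R p)) \<in> borel_measurable (Pi\<^sub>M Z (\<lambda>_. M) \<Otimes>\<^sub>M Pi\<^sub>M R (\<lambda>_. M))"
    by (rule measurable_compose[OF measurable_merge b_m])
  show "(\<lambda>z. \<integral>\<^sup>+l. a (merge Z L (z, l)) \<partial>Pi\<^sub>M L (\<lambda>_. M)) \<in> borel_measurable (Pi\<^sub>M Z (\<lambda>_. M))"
    by measurable
  show "(\<lambda>z. \<integral>\<^sup>+r. b (merge Z R (z, r)) \<partial>Pi\<^sub>M R (\<lambda>_. M)) \<in> borel_measurable (Pi\<^sub>M Z (\<lambda>_. M))"
    by measurable
  \<comment> \<open>Measurability over a partial product concerns extensional arguments only. A
    point of the full product must first be restricted, and \<open>depends_only_on\<close>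
    guarantees that this does not change the value.\<close>
  have rh: "h x = h (restrict x Z)" for x by (rule depends_only_onD[OF h']) (simp add: Z_def)
  have ra: "a x = a (restrict x (Z \<union> L))" for x by (rule depends_only_onD[OF a']) (auto simp: Z_def L_def)
  have rb: "b x = b (restrict x (Z \<union> R))" for x by (rule depends_only_onD[OF b']) (auto simp: Z_def R_def)
  have "(\<lambda>x. h (restrict x Z)) \<in> borel_measurable (Pi\<^sub>M V (\<lambda>_. M))"
    by (rule measurable_compose[OF measurable_restrict_subset h_m]) (auto simp: Z_def)
  moreover have "(\<lambda>x. a (restrict x (Z \<union> L))) \<in> borel_measurable (Pi\<^sub>M V (\<lambda>_. M))"
    by (rule measurable_compose[OF measurable_restrict_subset a_m]) (auto simp: Z_def L_def)
  moreover have "(\<lambda>x. b (restrict x (Z \<union> R))) \<in> borel_measurable (Pi\<^sub>M V (\<lambda>_. M))"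
    by (rule measurable_compose[OF measurable_restrict_subset b_m]) (auto simp: Z_def R_def)
  ultimately have "(\<lambda>x. h x * (a x * b x)) \<in> borel_measurable (Pi\<^sub>M V (\<lambda>_. M))"
    unfolding rh[symmetric] ra[symmetric] rb[symmetric] by measurable
  then have fm: "(\<lambda>x. h x * (a x * b x)) \<in> borel_measurable (Pi\<^sub>M (Z \<union> (L \<union> R)) (\<lambda>_. M))"
    using VZ by simp
  have inner: "(\<integral>\<^sup>+y. h (merge Z (L \<union> R) (z, y)) * (a (merge Z (L \<union> R) (z, y)) * b (merge Z (L \<union> R) (z, y)))
       \<partial>Pi\<^sub>M (L \<union> R) (\<lambda>_. M)) = h z * ((\<integral>\<^sup>+l. a (merge Z L (z, l)) \<partial>Pi\<^sub>M L (\<lambda>_. M)) *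
      (\<integral>\<^sup>+r. b (merge Z R (z, r)) \<partial>Pi\<^sub>M R (\<lambda>_. M)))" (is "?lhs = _")
    if z: "z \<in> space (Pi\<^sub>M Z (\<lambda>_. M))" for z
  proof -
    have fm': "(\<lambda>y. h (merge Z (L \<union> R) (z, y)) * (a (merge Z (L \<union> R) (z, y)) * b (merge Z (L \<union> R) (z, y))))
        \<in> borel_measurable (Pi\<^sub>M (L \<union> R) (\<lambda>_. M))"
      using measurable_compose[OF measurable_Pair1'[OF z] measurable_compose[OF measurable_merge fm]]
      by simp
    have az: "(\<lambda>l. a (merge Z L (z, l))) \<in> borel_measurable (Pi\<^sub>M L (\<lambda>_. M))"
      using measurable_compose[OF measurable_Pair1'[OF z] am2] by simp
    have bz: "(\<lambda>l. b (merge Z R (z, l))) \<in> borel_measurable (Pi\<^sub>M R (\<lambda>_. M))"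
      using measurable_compose[OF measurable_Pair1'[OF z] bm2] by simp
    have eq: "h (merge Z (L \<union> R) (z, merge L R (l, r))) = h z"
      "a (merge Z (L \<union> R) (z, merge L R (l, r))) = a (merge Z L (z, l))"
      "b (merge Z (L \<union> R) (z, merge L R (l, r))) = b (merge Z R (z, r))" for l r
      by (rule depends_only_onD[OF h'] depends_only_onD[OF a'] depends_only_onD[OF b'], auto simp: merge_def Z_def L_def R_def)+
    have "?lhs = (\<integral>\<^sup>+l. \<integral>\<^sup>+r. h z * (a (merge Z L (z, l)) * b (merge Z R (z, r))) \<partial>Pi\<^sub>M R (\<lambda>_. M) \<partial>Pi\<^sub>M L (\<lambda>_. M))"
      using product_nn_integral_fold[OF disj(2) fin(2,3) fm'] by (simp add: eq)
    also have "\<dots> = (\<integral>\<^sup>+l. h z * (a (merge Z L (z, l)) * (\<integral>\<^sup>+r. b (merge Z R (z, r)) \<partial>Pi\<^sub>M R (\<lambda>_. M))) \<partial>Pi\<^sub>M L (\<lambda>_. M))"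
      using bz by (simp add: nn_integral_cmult)
    also have "\<dots> = h z * ((\<integral>\<^sup>+l. a (merge Z L (z, l)) \<partial>Pi\<^sub>M L (\<lambda>_. M)) *
      (\<integral>\<^sup>+r. b (merge Z R (z, r)) \<partial>Pi\<^sub>M R (\<lambda>_. M)))"
      using az by (simp add: nn_integral_cmult nn_integral_multc)
    finally show ?thesis .
  qed
  have "(\<integral>\<^sup>+x. h x * (a x * b x) \<partial>Pi\<^sub>M V (\<lambda>_. M)) = (\<integral>\<^sup>+x. h x * (a x * b x) \<partial>Pi\<^sub>M (Z \<union> (L \<union> R)) (\<lambda>_. M))"
    using VZ by simp
  also have "\<dots> = (\<integral>\<^sup>+z. h z * ((\<integral>\<^sup>+l. a (merge Z L (z, l)) \<partial>Pi\<^sub>M L (\<lambda>_. M)) *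
      (\<integral>\<^sup>+r. b (merge Z R (z, r)) \<partial>Pi\<^sub>M R (\<lambda>_. M))) \<partial>Pi\<^sub>M Z (\<lambda>_. M))"
    by (subst product_nn_integral_fold[OF disj(1) fin(1) _ fm])
      (auto simp: fin inner intro!: nn_integral_cong)
  finally show "(\<integral>\<^sup>+x. h x * (a x * b x) \<partial>Pi\<^sub>M V (\<lambda>_. M)) =
    (\<integral>\<^sup>+z. h z * ((\<integral>\<^sup>+l. a (merge Z L (z, l)) \<partial>Pi\<^sub>M L (\<lambda>_. M)) *
      (\<integral>\<^sup>+r. b (merge Z R (z, r)) \<partial>Pi\<^sub>M R (\<lambda>_. M))) \<partial>Pi\<^sub>M Z (\<lambda>_. M))" .
qed

text \<open>The involution exchanges the two sides and fixes the cut pointwise. For fixed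
  coordinates on the cut, the reflected \<open>a\<close> therefore has the same integral over one
  side as \<open>a\<close> over the other. The three integrals become those of \<open>A * B\<close>,
  \<open>A\<^sup>2\<close> and \<open>B\<^sup>2\<close> against one measure on the cut.\<close>

lemma Cauchy_Schwarz_reflection:
  fixes M :: "'m measure" and \<sigma> :: "'v \<Rightarrow> real" and h a b :: "('v \<Rightarrow> 'm) \<Rightarrow> ennreal"
  assumes M: "prob_space M" and V: "finite V"
    and \<phi>: "\<And>v. v \<in> V \<Longrightarrow> \<phi> v \<in> V" "\<And>v. v \<in> V \<Longrightarrow> \<phi> (\<phi> v) = v"
      "\<And>v. v \<in> V \<Longrightarrow> \<sigma> (\<phi> v) = - \<sigma> v" "\<And>v. v \<in> V \<Longrightarrow> \<sigma> v = 0 \<Longrightarrow> \<phi> v = v"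
    and h: "h \<in> borel_measurable (Pi\<^sub>M {v \<in> V. \<sigma> v = 0} (\<lambda>_. M))"
    and a: "a \<in> borel_measurable (Pi\<^sub>M {v \<in> V. 0 \<le> \<sigma> v} (\<lambda>_. M))"
    and b: "b \<in> borel_measurable (Pi\<^sub>M {v \<in> V. \<sigma> v \<le> 0} (\<lambda>_. M))"
    and h': "depends_only_on {v \<in> V. \<sigma> v = 0} h"
    and a': "depends_only_on {v \<in> V. 0 \<le> \<sigma> v} a"
    and b': "depends_only_on {v \<in> V. \<sigma> v \<le> 0} b"
  shows "(\<integral>\<^sup>+x. h x * (a x * b x) \<partial>Pi\<^sub>M V (\<lambda>_. M))\<^sup>2 \<le>
    (\<integral>\<^sup>+x. h x * (a x * a (x \<circ> \<phi>)) \<partial>Pi\<^sub>M V (\<lambda>_. M)) *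
    (\<integral>\<^sup>+x. h x * (b (x \<circ> \<phi>) * b x) \<partial>Pi\<^sub>M V (\<lambda>_. M))"
proof -
  interpret M: prob_space M by fact
  have sf: "sigma_finite_measure M" by unfold_locales
  define Z where "Z = {v \<in> V. \<sigma> v = 0}"
  define L where "L = {v \<in> V. 0 < \<sigma> v}"
  define R where "R = {v \<in> V. \<sigma> v < 0}"
  note defs = Z_def L_def R_def
  have ZL: "{v \<in> V. 0 \<le> \<sigma> v} = Z \<union> L" and ZR: "{v \<in> V. \<sigma> v \<le> 0} = Z \<union> R"
    by (auto simp: defs)
  define A where "A z = (\<integral>\<^sup>+l. a (merge Z L (z, l)) \<partial>Pi\<^sub>M L (\<lambda>_. M))" for z
  define B where "B z = (\<integral>\<^sup>+r. b (merge Z R (z, r)) \<partial>Pi\<^sub>M R (\<lambda>_. M))" for z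
  have inj: "inj_on \<phi> V" by (rule inj_on_inverseI[of _ \<phi>]) (rule \<phi>(2))
  have ra: "a (x \<circ> \<phi>) = a (\<lambda>v\<in>Z \<union> L. x (\<phi> v))" for x
    by (rule depends_only_onD[OF a']) (auto simp: defs)
  have rb: "b (x \<circ> \<phi>) = b (\<lambda>v\<in>Z \<union> R. x (\<phi> v))" for x
    by (rule depends_only_onD[OF b']) (auto simp: defs)
  have am: "(\<lambda>x. a (x \<circ> \<phi>)) \<in> borel_measurable (Pi\<^sub>M {v \<in> V. \<sigma> v \<le> 0} (\<lambda>_. M))"
    unfolding ra using a unfolding ZL
    by (rule measurable_compose[rotated], intro measurable_restrict measurable_component_singleton)
      (auto simp: defs \<phi>(1,3))
  have bm: "(\<lambda>x. b (x \<circ> \<phi>)) \<in> borel_measurable (Pi\<^sub>M {v \<in> V. 0 \<le> \<sigma> v} (\<lambda>_. M))"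
    unfolding rb using b unfolding ZR
    by (rule measurable_compose[rotated], intro measurable_restrict measurable_component_singleton)
      (auto simp: defs \<phi>(1,3))
  have ad: "depends_only_on {v \<in> V. \<sigma> v \<le> 0} (\<lambda>x. a (x \<circ> \<phi>))"
    by (rule depends_only_onI, rule depends_only_onD[OF a']) (use \<phi> in auto)
  have bd: "depends_only_on {v \<in> V. 0 \<le> \<sigma> v} (\<lambda>x. b (x \<circ> \<phi>))"
    by (rule depends_only_onI, rule depends_only_onD[OF b']) (use \<phi> in auto)
  have "A z = (\<integral>\<^sup>+r. a (merge Z L (z, \<lambda>n\<in>L. r (\<phi> n))) \<partial>Pi\<^sub>M R (\<lambda>_. M))"
    if z: "z \<in> space (Pi\<^sub>M Z (\<lambda>_. M))" for z
  proof -
    have [measurable]: "(\<lambda>l. a (merge Z L (z, l))) \<in> borel_measurable (Pi\<^sub>M L (\<lambda>_. M))"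
      using measurable_compose[OF measurable_Pair1'[OF z] measurable_compose[OF measurable_merge a[unfolded ZL]]]
      by simp
    have [measurable]: "(\<lambda>\<omega>. \<lambda>n\<in>L. \<omega> (\<phi> n)) \<in> Pi\<^sub>M R (\<lambda>_. M) \<rightarrow>\<^sub>M Pi\<^sub>M L (\<lambda>_. M)"
      by (intro measurable_restrict measurable_component_singleton) (use \<phi> in \<open>auto simp: defs\<close>)
    \<comment> \<open>\<open>\<phi>\<close> maps \<open>L\<close> injectively into \<open>R\<close>,
      so relabelling coordinates along it pushes the product measure over \<open>R\<close> to the
      one over \<open>L\<close>.\<close>
    have d: "distr (Pi\<^sub>M R (\<lambda>_. M)) (Pi\<^sub>M L (\<lambda>_. M)) (\<lambda>\<omega>. \<lambda>n\<in>L. \<omega> (\<phi> n)) = Pi\<^sub>M L (\<lambda>_. M)"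
      by (rule distr_PiM_reindex) (use \<phi> M inj in \<open>auto simp: defs intro: inj_on_subset\<close>)
    show ?thesis unfolding A_def by (subst d[symmetric]) (simp add: nn_integral_distr)
  qed
  moreover have "a (merge Z L (z, \<lambda>n\<in>L. r (\<phi> n))) = a (merge Z R (z, r) \<circ> \<phi>)" for z r
    by (rule depends_only_onD[OF a']) (use \<phi> in \<open>auto simp: merge_def defs\<close>)
  ultimately have A2: "A z = (\<integral>\<^sup>+r. a (merge Z R (z, r) \<circ> \<phi>) \<partial>Pi\<^sub>M R (\<lambda>_. M))"
    if z: "z \<in> space (Pi\<^sub>M Z (\<lambda>_. M))" for z using z by simp
  have "B z = (\<integral>\<^sup>+r. b (merge Z R (z, \<lambda>n\<in>R. r (\<phi> n))) \<partial>Pi\<^sub>M L (\<lambda>_. M))"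
    if z: "z \<in> space (Pi\<^sub>M Z (\<lambda>_. M))" for z
  proof -
    have [measurable]: "(\<lambda>l. b (merge Z R (z, l))) \<in> borel_measurable (Pi\<^sub>M R (\<lambda>_. M))"
      using measurable_compose[OF measurable_Pair1'[OF z] measurable_compose[OF measurable_merge b[unfolded ZR]]]
      by simp
    have [measurable]: "(\<lambda>\<omega>. \<lambda>n\<in>R. \<omega> (\<phi> n)) \<in> Pi\<^sub>M L (\<lambda>_. M) \<rightarrow>\<^sub>M Pi\<^sub>M R (\<lambda>_. M)"
      by (intro measurable_restrict measurable_component_singleton) (use \<phi> in \<open>auto simp: defs\<close>)
    have d: "distr (Pi\<^sub>M L (\<lambda>_. M)) (Pi\<^sub>M R (\<lambda>_. M)) (\<lambda>\<omega>. \<lambda>n\<in>R. \<omega> (\<phi> n)) = Pi\<^sub>M R (\<lambda>_. M)"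
      by (rule distr_PiM_reindex) (use \<phi> M inj in \<open>auto simp: defs intro: inj_on_subset\<close>)
    show ?thesis unfolding B_def by (subst d[symmetric]) (simp add: nn_integral_distr)
  qed
  moreover have "b (merge Z R (z, \<lambda>n\<in>R. r (\<phi> n))) = b (merge Z L (z, r) \<circ> \<phi>)" for z r
    by (rule depends_only_onD[OF b']) (use \<phi> in \<open>auto simp: merge_def defs\<close>)
  ultimately have B2: "B z = (\<integral>\<^sup>+r. b (merge Z L (z, r) \<circ> \<phi>) \<partial>Pi\<^sub>M L (\<lambda>_. M))"
    if z: "z \<in> space (Pi\<^sub>M Z (\<lambda>_. M))" for z using z by simp
  have Ze: "{v \<in> V. \<sigma> v = 0} = Z" "{v \<in> V. 0 < \<sigma> v} = L" "{v \<in> V. \<sigma> v < 0} = R"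
    by (simp_all add: defs)
  note split = nn_integral_PiM_conditionally_independent[OF sf V h, unfolded Ze]
  note h' = h'[unfolded Ze]
  have Am: "A \<in> borel_measurable (Pi\<^sub>M Z (\<lambda>_. M))" and Bm: "B \<in> borel_measurable (Pi\<^sub>M Z (\<lambda>_. M))"
    using split(2,3)[OF a b h' a' b'] by (simp_all add: A_def[abs_def] B_def[abs_def])
  have hm: "h \<in> borel_measurable (Pi\<^sub>M Z (\<lambda>_. M))" using h by (simp only: Ze)
  \<comment> \<open>\<open>h\<close> is absorbed into the measure, so that Cauchy-Schwarz leaves it
    unsquared.\<close>
  have 1: "(\<integral>\<^sup>+x. h x * (a x * b x) \<partial>Pi\<^sub>M V (\<lambda>_. M)) = (\<integral>\<^sup>+z. A z * B z \<partial>density (Pi\<^sub>M Z (\<lambda>_. M)) h)"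
    unfolding split(1)[OF a b h' a' b'] A_def[symmetric] B_def[symmetric]
    using Am Bm hm by (simp add: nn_integral_density)
  have 2: "(\<integral>\<^sup>+x. h x * (a x * a (x \<circ> \<phi>)) \<partial>Pi\<^sub>M V (\<lambda>_. M)) = (\<integral>\<^sup>+z. (A z)\<^sup>2 \<partial>density (Pi\<^sub>M Z (\<lambda>_. M)) h)"
  proof -
    have "(\<integral>\<^sup>+x. h x * (a x * a (x \<circ> \<phi>)) \<partial>Pi\<^sub>M V (\<lambda>_. M)) =
        (\<integral>\<^sup>+z. h z * (A z * (\<integral>\<^sup>+r. a (merge Z R (z, r) \<circ> \<phi>) \<partial>Pi\<^sub>M R (\<lambda>_. M))) \<partial>Pi\<^sub>M Z (\<lambda>_. M))"
      unfolding split(1)[OF a am h' a' ad] A_def ..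
    also have "\<dots> = (\<integral>\<^sup>+z. h z * (A z)\<^sup>2 \<partial>Pi\<^sub>M Z (\<lambda>_. M))"
      by (intro nn_integral_cong) (simp add: A2[symmetric] power2_eq_square)
    also have "\<dots> = (\<integral>\<^sup>+z. (A z)\<^sup>2 \<partial>density (Pi\<^sub>M Z (\<lambda>_. M)) h)"
      using Am hm by (simp add: nn_integral_density)
    finally show ?thesis .
  qed
  have 3: "(\<integral>\<^sup>+x. h x * (b (x \<circ> \<phi>) * b x) \<partial>Pi\<^sub>M V (\<lambda>_. M)) = (\<integral>\<^sup>+z. (B z)\<^sup>2 \<partial>density (Pi\<^sub>M Z (\<lambda>_. M)) h)"
  proof -
    have "(\<integral>\<^sup>+x. h x * (b (x \<circ> \<phi>) * b x) \<partial>Pi\<^sub>M V (\<lambda>_. M)) =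
        (\<integral>\<^sup>+z. h z * ((\<integral>\<^sup>+r. b (merge Z L (z, r) \<circ> \<phi>) \<partial>Pi\<^sub>M L (\<lambda>_. M)) * B z) \<partial>Pi\<^sub>M Z (\<lambda>_. M))"
      unfolding split(1)[OF bm b h' bd b'] B_def ..
    also have "\<dots> = (\<integral>\<^sup>+z. h z * (B z)\<^sup>2 \<partial>Pi\<^sub>M Z (\<lambda>_. M))"
      by (intro nn_integral_cong) (simp add: B2[symmetric] power2_eq_square)
    also have "\<dots> = (\<integral>\<^sup>+z. (B z)\<^sup>2 \<partial>density (Pi\<^sub>M Z (\<lambda>_. M)) h)"
      using Bm hm by (simp add: nn_integral_density)
    finally show ?thesis .
  qed
  show ?thesis unfolding 1 2 3 using Am Bm by (intro Cauchy_Schwarz_nn_integral) auto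
qed

text \<open>Since no edge crosses the cut, the integrand factors into the edges within the cut and
  those on either side, as the reflection inequality requires. Composition with
  \<open>\<phi>\<close> turns the product over one side into a product over the other side with the
  weights carried along by \<open>\<psi>\<close>.\<close>

lemma prod_fold_Cauchy_Schwarz:
  fixes M :: "'m measure" and \<sigma> :: "'v \<Rightarrow> real" and W :: "'e \<Rightarrow> 'm \<times> 'm \<Rightarrow> ennreal"
  assumes M: "prob_space M" and V: "finite V" and E: "finite E"
    and \<phi>: "\<And>v. v \<in> V \<Longrightarrow> \<phi> v \<in> V" "\<And>v. v \<in> V \<Longrightarrow> \<phi> (\<phi> v) = v"
      "\<And>v. v \<in> V \<Longrightarrow> \<sigma> (\<phi> v) = - \<sigma> v" "\<And>v. v \<in> V \<Longrightarrow> \<sigma> v = 0 \<Longrightarrow> \<phi> v = v"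
    and st: "\<And>e. e \<in> E \<Longrightarrow> s e \<in> V" "\<And>e. e \<in> E \<Longrightarrow> t e \<in> V"
    and \<psi>: "\<And>e. e \<in> E \<Longrightarrow> \<psi> e \<in> E" "\<And>e. e \<in> E \<Longrightarrow> \<psi> (\<psi> e) = e"
      "\<And>e. e \<in> E \<Longrightarrow> s (\<psi> e) = \<phi> (s e)" "\<And>e. e \<in> E \<Longrightarrow> t (\<psi> e) = \<phi> (t e)"
    and cut: "\<And>e. e \<in> E \<Longrightarrow> 0 \<le> \<sigma> (s e) * \<sigma> (t e)"
    and W: "\<And>e. e \<in> E \<Longrightarrow> W e \<in> borel_measurable (M \<Otimes>\<^sub>M M)"
  shows "(\<integral>\<^sup>+x. (\<Prod>e\<in>E. W e (x (s e), x (t e))) \<partial>Pi\<^sub>M V (\<lambda>_. M))\<^sup>2 \<le>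
    (\<integral>\<^sup>+x. (\<Prod>e\<in>E. W (if \<sigma> (s e) + \<sigma> (t e) < 0 then \<psi> e else e) (x (s e), x (t e))) \<partial>Pi\<^sub>M V (\<lambda>_. M)) *
    (\<integral>\<^sup>+x. (\<Prod>e\<in>E. W (if 0 < \<sigma> (s e) + \<sigma> (t e) then \<psi> e else e) (x (s e), x (t e))) \<partial>Pi\<^sub>M V (\<lambda>_. M))"
proof -
  \<comment> \<open>By \<open>cut\<close> the signs at the two ends never conflict, so the sign of
    the sum tells the side of the edge, and the sum vanishes only if both ends lie on the
    cut.\<close>
  define side where "side e = \<sigma> (s e) + \<sigma> (t e)" for e
  define E0 where "E0 = {e \<in> E. side e = 0}"
  define EL where "EL = {e \<in> E. 0 < side e}"
  define ER where "ER = {e \<in> E. side e < 0}"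
  note defs = E0_def EL_def ER_def
  have fin: "finite E0" "finite EL" "finite ER" using E by (auto simp: defs)
  have EU: "E = E0 \<union> (EL \<union> ER)" and dj: "E0 \<inter> (EL \<union> ER) = {}" "EL \<inter> ER = {}"
    by (auto simp: defs)
  have s0: "\<sigma> (s e) = 0" "\<sigma> (t e) = 0" if "e \<in> E0" for e
  proof -
    have "\<sigma> (t e) = - \<sigma> (s e)" using that by (simp add: E0_def side_def)
    moreover have "0 \<le> \<sigma> (s e) * \<sigma> (t e)" using that cut[of e] by (simp add: E0_def)
    ultimately have "\<sigma> (s e) * \<sigma> (s e) \<le> 0" by simp
    then show "\<sigma> (s e) = 0" by (auto simp: mult_le_0_iff)
    with \<open>\<sigma> (t e) = - \<sigma> (s e)\<close> show "\<sigma> (t e) = 0" by simp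
  qed
  have sL: "0 \<le> \<sigma> (s e)" "0 \<le> \<sigma> (t e)" if "e \<in> EL" for e
    using that cut[of e] by (auto simp: defs side_def zero_le_mult_iff)
  have sR: "\<sigma> (s e) \<le> 0" "\<sigma> (t e) \<le> 0" if "e \<in> ER" for e
    using that cut[of e] by (auto simp: defs side_def zero_le_mult_iff)
  have sub: "e \<in> E" if "e \<in> E0 \<or> e \<in> EL \<or> e \<in> ER" for e using that by (auto simp: defs)
  define P where "P F x = (\<Prod>e\<in>F. W e (x (s e), x (t e)))" for F and x :: "'v \<Rightarrow> 'm"
  have prodU: "(\<Prod>e\<in>E. f e) = (\<Prod>e\<in>E0. f e) * ((\<Prod>e\<in>EL. f e) * (\<Prod>e\<in>ER. f e))" for f :: "'e \<Rightarrow> ennreal"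
    unfolding EU using fin dj by (simp add: prod.union_disjoint)
  have meas: "P F \<in> borel_measurable (Pi\<^sub>M U (\<lambda>_. M))"
    if "F \<subseteq> E" "\<And>e. e \<in> F \<Longrightarrow> s e \<in> U \<and> t e \<in> U" for F U
    unfolding P_def
  proof (rule borel_measurable_prod_ennreal)
    fix e assume e: "e \<in> F"
    then have "(\<lambda>x. (x (s e), x (t e))) \<in> Pi\<^sub>M U (\<lambda>_. M) \<rightarrow>\<^sub>M M \<Otimes>\<^sub>M M"
      using that by (intro measurable_Pair measurable_component_singleton) auto
    then show "(\<lambda>x. W e (x (s e), x (t e))) \<in> borel_measurable (Pi\<^sub>M U (\<lambda>_. M))"
      using W[of e] e that(1) by (rule_tac measurable_compose) auto
  qed
  have dep: "depends_only_on U (P F)" if "\<And>e. e \<in> F \<Longrightarrow> s e \<in> U \<and> t e \<in> U" for F U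
    unfolding P_def by (rule depends_only_onI, rule prod.cong) (auto simp: that)
  have \<psi>side: "side (\<psi> e) = - side e" if "e \<in> E" for e
    using that by (simp add: side_def \<psi> \<phi> st)
  have PL: "P EL (x \<circ> \<phi>) = (\<Prod>e\<in>ER. W (\<psi> e) (x (s e), x (t e)))" for x
    unfolding P_def
    by (rule prod.reindex_bij_witness[of _ \<psi> \<psi>]) (auto simp: defs \<psi> \<psi>side)
  have PR: "P ER (x \<circ> \<phi>) = (\<Prod>e\<in>EL. W (\<psi> e) (x (s e), x (t e)))" for x
    unfolding P_def
    by (rule prod.reindex_bij_witness[of _ \<psi> \<psi>]) (auto simp: defs \<psi> \<psi>side)
  have 1: "(\<Prod>e\<in>E. W e (x (s e), x (t e))) = P E0 x * (P EL x * P ER x)" for x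
    unfolding prodU P_def ..
  have 2: "(\<Prod>e\<in>E. W (if \<sigma> (s e) + \<sigma> (t e) < 0 then \<psi> e else e) (x (s e), x (t e)))
      = P E0 x * (P EL x * P EL (x \<circ> \<phi>))" for x
    unfolding prodU PL unfolding P_def
    by (intro arg_cong2[where f="(*)"] prod.cong) (auto simp: defs side_def)
  have 3: "(\<Prod>e\<in>E. W (if 0 < \<sigma> (s e) + \<sigma> (t e) then \<psi> e else e) (x (s e), x (t e)))
      = P E0 x * (P ER (x \<circ> \<phi>) * P ER x)" for x
    unfolding prodU PR unfolding P_def
    by (intro arg_cong2[where f="(*)"] prod.cong) (auto simp: defs side_def)
  show ?thesis unfolding 1 2 3
    by (rule Cauchy_Schwarz_reflection[where \<phi>=\<phi> and \<sigma>=\<sigma>, OF M V \<phi>])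
      (auto intro!: meas dep simp: s0 sL sR sub st)
qed

text \<open>A maximizer stays one when pulled back along \<open>f\<close>: both factors on the right
  are at most the maximum, and their product is at least its square, so a finite nonzero maximum
  cancels. The \<open>rank\<close> conditions let composites of such maps descend to the constant
  map \<open>e0\<close>, along which every set pulls back to \<open>E\<close> or
  \<open>{}\<close>.\<close>

lemma fold_extremal:
  fixes \<Phi> :: "'e set \<Rightarrow> ennreal" and rank :: "'e \<Rightarrow> real"
  assumes E: "finite E" and e0: "e0 \<in> E" and fin: "\<And>S. S \<subseteq> E \<Longrightarrow> \<Phi> S < top"
    and folds: "\<And>e. e \<in> E \<Longrightarrow> e \<noteq> e0 \<Longrightarrow> \<exists>f g. f ` E \<subseteq> E \<and> g ` E \<subseteq> E \<and>
      (\<forall>S\<subseteq>E. (\<Phi> S)\<^sup>2 \<le> \<Phi> {e\<in>E. f e \<in> S} * \<Phi> {e\<in>E. g e \<in> S}) \<and>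
      rank (f e) < rank e \<and> (\<forall>e'\<in>E. rank (f e') \<le> rank e')"
    and S: "S \<subseteq> E"
  shows "\<Phi> S \<le> max (\<Phi> E) (\<Phi> {})"
proof -
  define m where "m = Max (\<Phi> ` Pow E)"
  have m_ge: "\<Phi> T \<le> m" if "T \<subseteq> E" for T unfolding m_def using that E by (intro Max_ge) auto
  have "m \<in> \<Phi> ` Pow E" unfolding m_def using E by (intro Max_in) auto
  then obtain T where T: "T \<subseteq> E" "\<Phi> T = m" by auto
  have m_fin: "m < top" using fin T by auto
  show ?thesis
  proof (cases "m = 0")
    case True then show ?thesis using m_ge[OF S] by simp
  next
    case False
    \<comment> \<open>A composite of foldings that minimizes the total level is constant.\<close>
    define good where "good G \<longleftrightarrow> G ` E \<subseteq> E \<and>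
      (\<forall>S\<subseteq>E. \<Phi> S = m \<longrightarrow> \<Phi> {e\<in>E. G e \<in> S} = m)" for G
    \<comment> \<open>Real ranks are replaced by positions among the finitely many edges, so that a
      least total exists in the natural numbers.\<close>
    define level where "level e = card {e'\<in>E. rank e' < rank e}" for e
    have level_mono: "level e \<le> level e'" if "rank e \<le> rank e'" for e e'
      unfolding level_def using E that by (intro card_mono) auto
    have level_strict: "level e < level e'" if "rank e < rank e'" "e \<in> E" for e e'
      unfolding level_def using E that by (intro psubset_card_mono) auto
    have "good id" by (auto simp: good_def intro!: arg_cong[where f=\<Phi>])
    then obtain G where G: "good G"
      and G_min: "\<And>H. good H \<Longrightarrow> (\<Sum>e\<in>E. level (G e)) \<le> (\<Sum>e\<in>E. level (H e))"
      using ex_has_least_nat[of good id "\<lambda>G. \<Sum>e\<in>E. level (G e)"] by blast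
    have "G e = e0" if e: "e \<in> E" for e
    proof (rule ccontr)
      assume ne: "G e \<noteq> e0"
      have Ge: "G e \<in> E" using G e by (auto simp: good_def)
      from folds[OF Ge ne] obtain f g where fg: "f ` E \<subseteq> E" "g ` E \<subseteq> E"
          "\<forall>S\<subseteq>E. (\<Phi> S)\<^sup>2 \<le> \<Phi> {e\<in>E. f e \<in> S} * \<Phi> {e\<in>E. g e \<in> S}"
          "rank (f (G e)) < rank (G e)" "\<forall>e'\<in>E. rank (f e') \<le> rank e'"
        by (elim exE conjE)
      have f_max: "\<Phi> {e\<in>E. f e \<in> S} = m" if "S \<subseteq> E" "\<Phi> S = m" for S
      proof (rule antisym)
        show "\<Phi> {e\<in>E. f e \<in> S} \<le> m" by (rule m_ge) auto
        have "m * m \<le> \<Phi> {e\<in>E. f e \<in> S} * \<Phi> {e\<in>E. g e \<in> S}"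
          using fg(3)[rule_format, OF that(1)] that(2) by (simp add: power2_eq_square)
        also have "\<dots> \<le> \<Phi> {e\<in>E. f e \<in> S} * m" by (intro mult_left_mono m_ge) auto
        finally show "m \<le> \<Phi> {e\<in>E. f e \<in> S}"
          using False m_fin by (simp add: ennreal_mult_le_mult_iff mult.commute)
      qed
      have "good (f \<circ> G)"
      proof -
        \<comment> \<open>Preimages compose in reverse order: the set is pulled back along
          \<open>f\<close> first, which keeps it a maximizer, and only then along
          \<open>G\<close>.\<close>
        have "{e\<in>E. f (G e) \<in> S} = {e\<in>E. G e \<in> {e\<in>E. f e \<in> S}}" for S
          using G by (auto simp: good_def)
        moreover have "\<Phi> {e\<in>E. G e \<in> {e\<in>E. f e \<in> S}} = m" if "S \<subseteq> E" "\<Phi> S = m" for S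
        proof -
          have "{e\<in>E. f e \<in> S} \<subseteq> E" by auto
          then show ?thesis using G f_max[OF that] unfolding good_def by blast
        qed
        moreover have "(f \<circ> G) ` E \<subseteq> E" using G fg(1) by (auto simp: good_def)
        ultimately show ?thesis unfolding good_def by simp
      qed
      then have "(\<Sum>e\<in>E. level (G e)) \<le> (\<Sum>e\<in>E. level ((f \<circ> G) e))" by (rule G_min)
      moreover have "(\<Sum>e\<in>E. level ((f \<circ> G) e)) < (\<Sum>e\<in>E. level (G e))"
      proof (rule sum_strict_mono_ex1[OF E])
        show "\<forall>x\<in>E. level ((f \<circ> G) x) \<le> level (G x)"
          using G fg(5) by (auto simp: good_def intro!: level_mono)
        show "\<exists>a\<in>E. level ((f \<circ> G) a) < level (G a)"
          using e Ge fg(1,4) by (intro bexI[of _ e]) (auto intro!: level_strict)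
      qed
      ultimately show False by simp
    qed
    then have "{e\<in>E. G e \<in> T} = (if e0 \<in> T then E else {})" by auto
    moreover have "\<Phi> {e\<in>E. G e \<in> T} = m" using G T by (auto simp: good_def)
    ultimately have "m \<le> max (\<Phi> E) (\<Phi> {})" by (auto split: if_splits)
    then show ?thesis using m_ge[OF S] by (rule order_trans[rotated])
  qed
qed

section \<open>Percolating bipartite graphs\<close>

text \<open>The sign of \<open>\<sigma>\<close> or \<open>\<tau>\<close> tells on which side of the cut a vertex lies; zero means on the cut.\<close>

definition cut_involution ::
  "'a set \<Rightarrow> 'b set \<Rightarrow> ('a \<times> 'b) set \<Rightarrow> ('a \<Rightarrow> 'a) \<Rightarrow> ('b \<Rightarrow> 'b) \<Rightarrow> ('a \<Rightarrow> real) \<Rightarrow> ('b \<Rightarrow> real) \<Rightarrow> bool" where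
  "cut_involution A B E \<phi> \<psi> \<sigma> \<tau> \<longleftrightarrow>
     (\<forall>a\<in>A. \<phi> a \<in> A \<and> \<phi> (\<phi> a) = a \<and> \<sigma> (\<phi> a) = - \<sigma> a \<and> (\<sigma> a = 0 \<longrightarrow> \<phi> a = a)) \<and>
     (\<forall>b\<in>B. \<psi> b \<in> B \<and> \<psi> (\<psi> b) = b \<and> \<tau> (\<psi> b) = - \<tau> b \<and> (\<tau> b = 0 \<longrightarrow> \<psi> b = b)) \<and>
     (\<forall>(a, b)\<in>E. (\<phi> a, \<psi> b) \<in> E \<and> 0 \<le> \<sigma> a * \<tau> b)"

text \<open>A single \<open>rank\<close> shared by all cuts replaces an explicit sequence of
  foldings ending in \<open>e0\<close>. In this form the distance to a fixed point can serve as the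
  certificate.\<close>

definition percolating :: "'a set \<Rightarrow> 'b set \<Rightarrow> ('a \<times> 'b) set \<Rightarrow> ('a \<times> 'b) \<Rightarrow> bool" where
  "percolating A B E e0 \<longleftrightarrow> finite A \<and> finite B \<and> E \<subseteq> A \<times> B \<and> e0 \<in> E \<and>
     (\<exists>rank :: 'a \<times> 'b \<Rightarrow> real. \<forall>(a, b)\<in>E - {e0}. \<exists>\<phi> \<psi> \<sigma> \<tau>. cut_involution A B E \<phi> \<psi> \<sigma> \<tau> \<and>
        \<sigma> a + \<tau> b < 0 \<and> (\<forall>(c, d)\<in>E. \<sigma> c + \<tau> d < 0 \<longrightarrow> rank (\<phi> c, \<psi> d) < rank (c, d)))"

text \<open>The extremal argument cancels the maximum, so it needs finite values; the uniform bound
  \<open>K\<close> on a probability space provides them.\<close>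

lemma percolating_colouring_bound:
  fixes M :: "'m measure" and f g :: "'m \<times> 'm \<Rightarrow> ennreal"
  assumes M: "prob_space M" and perc: "percolating A B E e0"
    and f: "f \<in> borel_measurable (M \<Otimes>\<^sub>M M)" and g: "g \<in> borel_measurable (M \<Otimes>\<^sub>M M)"
    and bd: "\<And>p. f p \<le> K" "\<And>p. g p \<le> K" and K: "K < top"
  defines "\<Phi> \<equiv> \<lambda>S. \<integral>\<^sup>+x. (\<Prod>e\<in>E. (if e \<in> S then f else g) (x (Inl (fst e)), x (Inr (snd e))))
    \<partial>Pi\<^sub>M (A <+> B) (\<lambda>_. M)"
  assumes S: "S \<subseteq> E"
  shows "\<Phi> S \<le> max (\<Phi> E) (\<Phi> {})"
proof -
  interpret M: prob_space M by fact
  from perc[unfolded percolating_def] obtain rank :: "'a \<times> 'b \<Rightarrow> real"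
    where fin: "finite A" "finite B" and E: "E \<subseteq> A \<times> B" and e0: "e0 \<in> E"
    and rank: "\<forall>(a, b)\<in>E - {e0}. \<exists>\<phi> \<psi> \<sigma> \<tau>. cut_involution A B E \<phi> \<psi> \<sigma> \<tau> \<and>
        \<sigma> a + \<tau> b < 0 \<and> (\<forall>(c, d)\<in>E. \<sigma> c + \<tau> d < 0 \<longrightarrow> rank (\<phi> c, \<psi> d) < rank (c, d))"
    by (elim conjE exE)
  have finE: "finite E" using E fin finite_subset by blast
  interpret P: prob_space "Pi\<^sub>M (A <+> B) (\<lambda>_. M)" by (intro prob_space_PiM M)
  show ?thesis
  proof (rule fold_extremal[OF finE e0, where rank=rank, OF _ _ S])
    fix S assume "S \<subseteq> E"
    have "\<Phi> S \<le> (\<integral>\<^sup>+x. (\<Prod>e\<in>E. K) \<partial>Pi\<^sub>M (A <+> B) (\<lambda>_. M))"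
      unfolding \<Phi>_def by (intro nn_integral_mono prod_mono_ennreal) (auto simp: bd)
    also have "\<dots> = K ^ card E" by (simp add: P.emeasure_space_1)
    also have "\<dots> < top" using K by (simp add: power_less_top_ennreal)
    finally show "\<Phi> S < top" .
  next
    fix e assume e: "e \<in> E" "e \<noteq> e0"
    obtain a b where ab: "e = (a, b)" by (cases e)
    have "\<exists>\<phi> \<psi> \<sigma> \<tau>. cut_involution A B E \<phi> \<psi> \<sigma> \<tau> \<and> \<sigma> a + \<tau> b < 0 \<and>
        (\<forall>(c, d)\<in>E. \<sigma> c + \<tau> d < 0 \<longrightarrow> rank (\<phi> c, \<psi> d) < rank (c, d))"
      using bspec[OF rank, of e] e by (simp add: ab)
    then obtain \<phi> \<psi> \<sigma> \<tau> where cut: "cut_involution A B E \<phi> \<psi> \<sigma> \<tau>"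
      and far: "\<sigma> a + \<tau> b < 0"
      and dec: "\<forall>(c, d)\<in>E. \<sigma> c + \<tau> d < 0 \<longrightarrow> rank (\<phi> c, \<psi> d) < rank (c, d)"
      by (elim exE conjE)
    \<comment> \<open>\<open>map_sum\<close> respects the two parts, so the two arguments of a
      kernel are never exchanged and the kernels may be asymmetric.\<close>
    let ?\<sigma> = "case_sum \<sigma> \<tau>" and ?\<phi> = "map_sum \<phi> \<psi>" and ?\<psi> = "map_prod \<phi> \<psi>"
    let ?s = "\<lambda>e. Inl (fst e) :: 'a + 'b" and ?t = "\<lambda>e. Inr (snd e) :: 'a + 'b"
    define f' where "f' e = (if ?\<sigma> (?s e) + ?\<sigma> (?t e) < 0 then ?\<psi> e else e)" for e
    define g' where "g' e = (if 0 < ?\<sigma> (?s e) + ?\<sigma> (?t e) then ?\<psi> e else e)" for e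
    note cut' = cut[unfolded cut_involution_def]
    have f'E: "f' e \<in> E" "g' e \<in> E" if "e \<in> E" for e
      using that cut' by (auto simp: f'_def g'_def)
    have CS: "(\<Phi> S)\<^sup>2 \<le> \<Phi> {e\<in>E. f' e \<in> S} * \<Phi> {e\<in>E. g' e \<in> S}" if "S \<subseteq> E" for S
    proof -
      let ?W = "\<lambda>e. if e \<in> S then f else g"
      have eq: "\<Phi> {e\<in>E. h e \<in> S} = (\<integral>\<^sup>+x. (\<Prod>e\<in>E. ?W (h e) (x (?s e), x (?t e))) \<partial>Pi\<^sub>M (A <+> B) (\<lambda>_. M))" for h
        unfolding \<Phi>_def by (intro nn_integral_cong prod.cong) auto
      show ?thesis unfolding eq f'_def g'_def unfolding \<Phi>_def
        by (rule prod_fold_Cauchy_Schwarz[where \<sigma>="?\<sigma>" and \<phi>="?\<phi>" and \<psi>="?\<psi>", OF M _ finE])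
          (use fin E f g cut' in auto)
    qed
    have "rank (f' e) < rank e" using bspec[OF dec, of e] e far by (simp add: f'_def ab)
    moreover have "rank (f' e') \<le> rank e'" if "e' \<in> E" for e'
      using bspec[OF dec, of e'] that by (cases e') (auto simp: f'_def)
    ultimately show "\<exists>f g. f ` E \<subseteq> E \<and> g ` E \<subseteq> E \<and>
      (\<forall>S\<subseteq>E. (\<Phi> S)\<^sup>2 \<le> \<Phi> {e\<in>E. f e \<in> S} * \<Phi> {e\<in>E. g e \<in> S}) \<and>
      rank (f e) < rank e \<and> (\<forall>e'\<in>E. rank (f e') \<le> rank e')"
      using CS f'E by (intro exI[of _ f'] exI[of _ g']) auto
  qed
qed

text \<open>The ends of an edge are distinct elements of the disjoint sum, so they receive an
  independent pair of points. This carries null sets of the square over to null sets of vertex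
  assignments, one edge at a time.\<close>

lemma distr_PiM_pair:
  assumes M: "prob_space M" and V: "finite V" and uv: "u \<in> V" "v \<in> V" "u \<noteq> v"
  shows "distr (Pi\<^sub>M V (\<lambda>_. M)) (M \<Otimes>\<^sub>M M) (\<lambda>x. (x u, x v)) = M \<Otimes>\<^sub>M M"
proof (rule pair_measure_eqI[symmetric])
  interpret M: prob_space M by fact
  interpret product_prob_space "\<lambda>_. M" V by standard
  show "sigma_finite_measure M" "sigma_finite_measure M" by unfold_locales
  show "sets (M \<Otimes>\<^sub>M M) = sets (distr (Pi\<^sub>M V (\<lambda>_. M)) (M \<Otimes>\<^sub>M M) (\<lambda>x. (x u, x v)))" by simp
  fix X Y assume XY: "X \<in> sets M" "Y \<in> sets M"
  \<comment> \<open>\<open>Q\<close> leaves every other coordinate unconstrained, so that it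
    contributes the factor 1.\<close>
  define Q where "Q i = (if i = u then X else if i = v then Y else space M)" for i
  have Q: "Q i \<in> sets M" for i using XY by (simp add: Q_def)
  have [measurable]: "(\<lambda>x. (x u, x v)) \<in> Pi\<^sub>M V (\<lambda>_. M) \<rightarrow>\<^sub>M M \<Otimes>\<^sub>M M"
    using uv by (intro measurable_Pair measurable_component_singleton) auto
  have "(\<lambda>x. (x u, x v)) -` (X \<times> Y) \<inter> space (Pi\<^sub>M V (\<lambda>_. M)) = Pi\<^sub>E V Q"
  proof (intro equalityI subsetI)
    fix x assume "x \<in> (\<lambda>x. (x u, x v)) -` (X \<times> Y) \<inter> space (Pi\<^sub>M V (\<lambda>_. M))"
    then show "x \<in> Pi\<^sub>E V Q" by (auto simp: space_PiM Q_def PiE_iff)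
  next
    fix x assume x: "x \<in> Pi\<^sub>E V Q"
    have "x \<in> Pi\<^sub>E V (\<lambda>_. space M)"
      using x sets.sets_into_space[OF Q] by (auto simp: PiE_iff)
    moreover have "x u \<in> X" "x v \<in> Y" using x uv by (auto simp: PiE_iff Q_def)
    ultimately show "x \<in> (\<lambda>x. (x u, x v)) -` (X \<times> Y) \<inter> space (Pi\<^sub>M V (\<lambda>_. M))"
      by (simp add: space_PiM)
  qed
  then have "emeasure (distr (Pi\<^sub>M V (\<lambda>_. M)) (M \<Otimes>\<^sub>M M) (\<lambda>x. (x u, x v))) (X \<times> Y) = (\<Prod>i\<in>V. emeasure M (Q i))"
    using XY Q V by (subst emeasure_distr) (auto simp: emeasure_PiM)
  also have "\<dots> = (\<Prod>i\<in>{u, v}. emeasure M (Q i))"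
    using V uv by (intro prod.mono_neutral_right) (auto simp: Q_def M.emeasure_space_1)
  also have "\<dots> = emeasure M X * emeasure M Y" using uv by (simp add: Q_def)
  finally show "emeasure M X * emeasure M Y =
    emeasure (distr (Pi\<^sub>M V (\<lambda>_. M)) (M \<Otimes>\<^sub>M M) (\<lambda>x. (x u, x v))) (X \<times> Y)" by simp
qed

section \<open>Homomorphism integrals: triangle inequality and definiteness\<close>

definition hom_integral :: "'m measure \<Rightarrow> 'a set \<Rightarrow> 'b set \<Rightarrow> ('a \<times> 'b) set \<Rightarrow> ('m \<times> 'm \<Rightarrow> ennreal) \<Rightarrow> ennreal" where
  "hom_integral M A B E f =
     (\<integral>\<^sup>+x. (\<Prod>e\<in>E. f (x (Inl (fst e)), x (Inr (snd e)))) \<partial>Pi\<^sub>M (A <+> B) (\<lambda>_. M))"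

lemma measurable_hom_integrand:
  assumes "E \<subseteq> A \<times> B" and "\<And>e. e \<in> E \<Longrightarrow> W e \<in> borel_measurable (M \<Otimes>\<^sub>M M)"
  shows "(\<lambda>x. \<Prod>e\<in>E. W e (x (Inl (fst e)), x (Inr (snd e))) :: ennreal)
    \<in> borel_measurable (Pi\<^sub>M (A <+> B) (\<lambda>_. M))"
proof (rule borel_measurable_prod_ennreal)
  fix e assume e: "e \<in> E"
  then have "(\<lambda>x. (x (Inl (fst e)), x (Inr (snd e)))) \<in> Pi\<^sub>M (A <+> B) (\<lambda>_. M) \<rightarrow>\<^sub>M M \<Otimes>\<^sub>M M"
    using assms(1) by (intro measurable_Pair measurable_component_singleton) auto
  then show "(\<lambda>x. W e (x (Inl (fst e)), x (Inr (snd e)))) \<in> borel_measurable (Pi\<^sub>M (A <+> B) (\<lambda>_. M))"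
    using assms(2)[OF e] by (rule measurable_compose)
qed

lemma hom_integral_cmult:
  assumes "E \<subseteq> A \<times> B" and "f \<in> borel_measurable (M \<Otimes>\<^sub>M M)"
  shows "hom_integral M A B E (\<lambda>p. c * f p) = c ^ card E * hom_integral M A B E f"
  unfolding hom_integral_def prod.distrib prod_constant
  by (rule nn_integral_cmult) (rule measurable_hom_integrand, use assms in auto)

lemma hom_integral_mono:
  "(\<And>p. f p \<le> g p) \<Longrightarrow> hom_integral M A B E f \<le> hom_integral M A B E g"
  unfolding hom_integral_def by (intro nn_integral_mono prod_mono_ennreal) auto

lemma hom_integral_const:
  assumes "prob_space M"
  shows "hom_integral M A B E (\<lambda>_. c) = c ^ card E"
proof -
  interpret P: prob_space "Pi\<^sub>M (A <+> B) (\<lambda>_. M)" by (intro prob_space_PiM assms)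
  show ?thesis by (simp add: hom_integral_def P.emeasure_space_1)
qed

text \<open>After division by \<open>a\<close> and \<open>b\<close> both monochromatic integrals are
  at most 1, hence so is every mixed one, and the expanded product adds up to
  \<open>(a + b) ^ card E\<close>. Strictly positive bounds stand in for the two norms, which may
  vanish and so cannot be divided by.\<close>

lemma hom_integral_add_le:
  fixes M :: "'m measure" and E :: "('a \<times> 'b) set" and f g :: "'m \<times> 'm \<Rightarrow> ennreal"
  assumes M: "prob_space M" and perc: "percolating A B E e0"
    and f: "f \<in> borel_measurable (M \<Otimes>\<^sub>M M)" and g: "g \<in> borel_measurable (M \<Otimes>\<^sub>M M)"
    and bd: "\<And>p. f p \<le> K" "\<And>p. g p \<le> K" and K: "K < top"
    and a: "0 < a" "a < top" "hom_integral M A B E f \<le> a ^ card E"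
    and b: "0 < b" "b < top" "hom_integral M A B E g \<le> b ^ card E"
  shows "hom_integral M A B E (\<lambda>p. f p + g p) \<le> (a + b) ^ card E"
proof -
  have E: "E \<subseteq> A \<times> B" and finE: "finite E"
    using perc finite_subset[of E "A \<times> B"] by (auto simp: percolating_def)
  define f' where "f' p = inverse a * f p" for p
  define g' where "g' p = inverse b * g p" for p
  have ff: "f p = a * f' p" for p
    using a by (simp add: f'_def mult.assoc[symmetric] ennreal_divide_self flip: divide_ennreal_def)
  have gg: "g p = b * g' p" for p
    using b by (simp add: g'_def mult.assoc[symmetric] ennreal_divide_self flip: divide_ennreal_def)
  have f'm: "f' \<in> borel_measurable (M \<Otimes>\<^sub>M M)" and g'm: "g' \<in> borel_measurable (M \<Otimes>\<^sub>M M)"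
    unfolding f'_def[abs_def] g'_def[abs_def] using f g by auto
  have "a ^ card E * hom_integral M A B E f' \<le> a ^ card E * 1"
    using a(3) hom_integral_cmult[OF E f'm, of a] by (simp add: ff[symmetric])
  then have f'1: "hom_integral M A B E f' \<le> 1"
    using a(1,2) by (subst (asm) ennreal_mult_le_mult_iff) (auto simp: power_eq_top_ennreal)
  have "b ^ card E * hom_integral M A B E g' \<le> b ^ card E * 1"
    using b(3) hom_integral_cmult[OF E g'm, of b] by (simp add: gg[symmetric])
  then have g'1: "hom_integral M A B E g' \<le> 1"
    using b(1,2) by (subst (asm) ennreal_mult_le_mult_iff) (auto simp: power_eq_top_ennreal)
  define K' where "K' = max (inverse a * K) (inverse b * K)"
  have "inverse a < top" "inverse b < top" using a b by (simp_all add: less_top[symmetric] zero_less_iff_neq_zero)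
  then have K': "K' < top" using K by (auto simp: K'_def ennreal_mult_less_top max_def)
  have bd': "f' p \<le> K'" "g' p \<le> K'" for p
    unfolding f'_def g'_def K'_def
    by (rule max.coboundedI1 max.coboundedI2, rule mult_left_mono[OF _ zero_le], rule bd)+
  define \<Phi> where "\<Phi> S = (\<integral>\<^sup>+x. (\<Prod>e\<in>E. (if e \<in> S then f' else g') (x (Inl (fst e)), x (Inr (snd e))))
    \<partial>Pi\<^sub>M (A <+> B) (\<lambda>_. M))" for S
  have \<Phi>_le: "\<Phi> S \<le> 1" if "S \<subseteq> E" for S
  proof -
    have "\<Phi> S \<le> max (\<Phi> E) (\<Phi> {})"
      unfolding \<Phi>_def by (rule percolating_colouring_bound[OF M perc f'm g'm bd' K' that])
    moreover have "\<Phi> E = hom_integral M A B E f'" unfolding \<Phi>_def hom_integral_def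
      by (intro nn_integral_cong prod.cong) auto
    moreover have "\<Phi> {} = hom_integral M A B E g'" unfolding \<Phi>_def hom_integral_def by simp
    ultimately show ?thesis using f'1 g'1 by (simp add: max_def split: if_splits)
  qed
  \<comment> \<open>The expansion runs over the set \<open>S\<close> of edges at which the summand
    \<open>f\<close> is chosen.\<close>
  have "(\<Prod>e\<in>E. f (z e) + g (z e)) = (\<Sum>S\<in>Pow E. a ^ card S * b ^ card (E - S) *
      (\<Prod>e\<in>E. (if e \<in> S then f' else g') (z e)))" for z :: "'a \<times> 'b \<Rightarrow> 'm \<times> 'm"
    unfolding prod_add[OF finE]
  proof (rule sum.cong[OF refl])
    fix S assume S: "S \<in> Pow E"
    have "(\<Prod>e\<in>E. (if e \<in> S then f' else g') (z e)) =
        (\<Prod>e\<in>S. (if e \<in> S then f' else g') (z e)) * (\<Prod>e\<in>E - S. (if e \<in> S then f' else g') (z e))"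
      using S finE by (simp add: prod.subset_diff mult.commute)
    also have "\<dots> = (\<Prod>e\<in>S. f' (z e)) * (\<Prod>e\<in>E - S. g' (z e))" by simp
    finally show "(\<Prod>e\<in>S. f (z e)) * (\<Prod>e\<in>E - S. g (z e)) =
        a ^ card S * b ^ card (E - S) * (\<Prod>e\<in>E. (if e \<in> S then f' else g') (z e))"
      by (simp add: ff gg prod.distrib ac_simps)
  qed
  then have "hom_integral M A B E (\<lambda>p. f p + g p) =
      (\<Sum>S\<in>Pow E. \<integral>\<^sup>+x. a ^ card S * b ^ card (E - S) *
      (\<Prod>e\<in>E. (if e \<in> S then f' else g') (x (Inl (fst e)), x (Inr (snd e)))) \<partial>Pi\<^sub>M (A <+> B) (\<lambda>_. M))"
    unfolding hom_integral_def
    by (simp only:) (intro nn_integral_sum borel_measurable_times_ennreal borel_measurable_const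
        measurable_hom_integrand E, use f'm g'm in auto)
  also have "\<dots> = (\<Sum>S\<in>Pow E. a ^ card S * b ^ card (E - S) * \<Phi> S)"
    unfolding \<Phi>_def
    by (intro sum.cong refl nn_integral_cmult measurable_hom_integrand E) (use f'm g'm in auto)
  also have "\<dots> \<le> (\<Sum>S\<in>Pow E. a ^ card S * b ^ card (E - S) * 1)"
    by (intro sum_mono mult_left_mono \<Phi>_le) auto
  also have "\<dots> = (\<Prod>e\<in>E. a + b)" unfolding prod_add[OF finE] by simp
  finally show ?thesis by simp
qed

text \<open>For the harder direction a scale \<open>n\<close> decides: a mixed integral linear in
  \<open>n\<close> is bounded by the larger of the monochromatic values 0 and 1, which does not grow
  with \<open>n\<close>.\<close>

lemma hom_integral_eq_0_iff:
  assumes M: "prob_space M" and perc: "percolating A B E e0"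
    and f: "f \<in> borel_measurable (M \<Otimes>\<^sub>M M)" and bd: "\<And>p. f p \<le> K" and K: "K < top"
  shows "hom_integral M A B E f = 0 \<longleftrightarrow> (AE p in M \<Otimes>\<^sub>M M. f p = 0)"
proof -
  interpret M: prob_space M by fact
  have E: "E \<subseteq> A \<times> B" and e0: "e0 \<in> E" and fin: "finite A" "finite B" 
    using perc by (auto simp: percolating_def)
  have finE: "finite E" using fin E finite_subset by blast
  let ?P = "Pi\<^sub>M (A <+> B) (\<lambda>_. M)" and ?z = "\<lambda>x. (x (Inl (fst e0)), x (Inr (snd e0)))"
  have zm: "?z \<in> ?P \<rightarrow>\<^sub>M M \<Otimes>\<^sub>M M"
    using E e0 by (intro measurable_Pair measurable_component_singleton) auto
  have d: "distr ?P (M \<Otimes>\<^sub>M M) ?z = M \<Otimes>\<^sub>M M"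
    using E e0 fin by (intro distr_PiM_pair M) auto
  show ?thesis
  proof
    assume ae: "AE p in M \<Otimes>\<^sub>M M. f p = 0"
    have "AE p in distr ?P (M \<Otimes>\<^sub>M M) ?z. f p = 0" unfolding d by (rule ae)
    then have "AE x in ?P. f (?z x) = 0" using zm by (rule AE_distrD[rotated])
    then have "AE x in ?P. (\<Prod>e\<in>E. f (x (Inl (fst e)), x (Inr (snd e)))) = 0"
      by eventually_elim (use e0 finE in \<open>auto simp: prod_zero_iff\<close>)
    then show "hom_integral M A B E f = 0" unfolding hom_integral_def
      by (subst nn_integral_0_iff_AE) (use measurable_hom_integrand[OF E, of "\<lambda>_. f"] f in auto)
  next
    assume 0: "hom_integral M A B E f = 0"
    \<comment> \<open>Colour \<open>e0\<close> by \<open>n * f\<close> and all other edges by \<open>1\<close>.\<close>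
    have le: "of_nat n * (\<integral>\<^sup>+p. f p \<partial>(M \<Otimes>\<^sub>M M)) \<le> 1" for n :: nat
    proof -
      let ?f = "\<lambda>p. of_nat n * f p" and ?W = "\<lambda>e. if e \<in> {e0} then (\<lambda>p. of_nat n * f p) else (\<lambda>_. 1)"
      let ?K = "max 1 (of_nat n * K)"
      have "(\<integral>\<^sup>+x. (\<Prod>e\<in>E. ?W e (x (Inl (fst e)), x (Inr (snd e)))) \<partial>?P) \<le>
          max (\<integral>\<^sup>+x. (\<Prod>e\<in>E. (if e \<in> E then ?f else (\<lambda>_. 1)) (x (Inl (fst e)), x (Inr (snd e)))) \<partial>?P)
            (\<integral>\<^sup>+x. (\<Prod>e\<in>E. (if e \<in> {} then ?f else (\<lambda>_. 1)) (x (Inl (fst e)), x (Inr (snd e)))) \<partial>?P)"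
        by (rule percolating_colouring_bound[OF M perc, where K="?K"])
          (use f e0 K in \<open>auto simp: bd ennreal_mult_less_top of_nat_less_top max.coboundedI2 mult_left_mono\<close>)
      also have "(\<integral>\<^sup>+x. (\<Prod>e\<in>E. (if e \<in> {} then ?f else (\<lambda>_. 1)) (x (Inl (fst e)), x (Inr (snd e)))) \<partial>?P) = 1"
        using hom_integral_const[OF M, of A B E 1] by (simp add: hom_integral_def)
      also have "(\<integral>\<^sup>+x. (\<Prod>e\<in>E. (if e \<in> E then ?f else (\<lambda>_. 1)) (x (Inl (fst e)), x (Inr (snd e)))) \<partial>?P)
          = hom_integral M A B E ?f"
        unfolding hom_integral_def by (intro nn_integral_cong prod.cong) auto
      also have "\<dots> = 0" using hom_integral_cmult[OF E f, of "of_nat n"] 0 by simp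
      also have "(\<integral>\<^sup>+x. (\<Prod>e\<in>E. ?W e (x (Inl (fst e)), x (Inr (snd e)))) \<partial>?P) = (\<integral>\<^sup>+x. ?f (?z x) \<partial>?P)"
      proof (rule nn_integral_cong)
        fix x
        have "(\<Prod>e\<in>E. ?W e (x (Inl (fst e)), x (Inr (snd e)))) = (\<Prod>e\<in>{e0}. ?W e (x (Inl (fst e)), x (Inr (snd e))))"
          using finE e0 by (intro prod.mono_neutral_right) auto
        then show "(\<Prod>e\<in>E. ?W e (x (Inl (fst e)), x (Inr (snd e)))) = ?f (?z x)" by simp
      qed
      also have "\<dots> = (\<integral>\<^sup>+p. ?f p \<partial>distr ?P (M \<Otimes>\<^sub>M M) ?z)"
        using zm f by (simp add: nn_integral_distr)
      also have "\<dots> = of_nat n * (\<integral>\<^sup>+p. f p \<partial>(M \<Otimes>\<^sub>M M))"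
        unfolding d using f by (simp add: nn_integral_cmult)
      finally show ?thesis by simp
    qed
    have "(\<integral>\<^sup>+p. f p \<partial>(M \<Otimes>\<^sub>M M)) = 0"
    proof (rule ccontr)
      assume nz: "(\<integral>\<^sup>+p. f p \<partial>(M \<Otimes>\<^sub>M M)) \<noteq> 0"
      obtain r where r: "0 \<le> r" "(\<integral>\<^sup>+p. f p \<partial>(M \<Otimes>\<^sub>M M)) = ennreal r"
        using le[of 1] by (cases "\<integral>\<^sup>+p. f p \<partial>(M \<Otimes>\<^sub>M M)") (auto simp: top_unique)
      with nz have "0 < r" by (cases "r = 0") auto
      then obtain n :: nat where "1 < real n * r" using reals_Archimedean3 by blast
      moreover have "ennreal (real n * r) \<le> ennreal 1"
        using le[of n] r by (simp add: ennreal_mult ennreal_of_nat_eq_real_of_nat)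
      ultimately show False using ennreal_le_iff[of 1 "real n * r"] by linarith
    qed
    then show "AE p in M \<Otimes>\<^sub>M M. f p = 0" using f by (simp add: nn_integral_0_iff_AE)
  qed
qed

section \<open>Lebesgue measurable functions and their Borel representatives\<close>

lemma (in complete_measure) borel_measurable_AE_cong:
  fixes f g :: "'a \<Rightarrow> 'b::topological_space"
  assumes g: "g \<in> borel_measurable M" and ae: "AE x in M. f x = g x"
  shows "f \<in> borel_measurable M"
proof (rule measurableI)
  fix S :: "'b set" assume S: "S \<in> sets borel"
  show "f -` S \<inter> space M \<in> sets M"
  proof (rule in_sets_AE)
    show "AE x in M. x \<in> g -` S \<inter> space M \<longleftrightarrow> x \<in> f -` S \<inter> space M"
      using ae by eventually_elim auto
    show "g -` S \<inter> space M \<in> sets M" using g S by (rule measurable_sets)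
  qed auto
qed auto

abbreviation unit_interval_measure :: "real measure" (\<open>\<mu>\<close>) where
  "\<mu> \<equiv> lebesgue_on {0..1}"

lemma prob_space_unit_interval: "prob_space \<mu>"
  by (rule prob_spaceI) (simp add: emeasure_restrict_space)

lemma borel_measurable_unit_square:
  fixes g :: "real \<times> real \<Rightarrow> 'c::topological_space"
  assumes "g \<in> borel_measurable borel"
  shows "g \<in> borel_measurable (\<mu> \<Otimes>\<^sub>M \<mu>)"
proof -
  have id: "(\<lambda>x. x) \<in> borel_measurable \<mu>"
    by (rule measurable_restrict_space1) (auto intro: measurable_completion)
  have "(\<lambda>p. (fst p, snd p)) \<in> \<mu> \<Otimes>\<^sub>M \<mu> \<rightarrow>\<^sub>M borel \<Otimes>\<^sub>M borel"
    using measurable_compose[OF measurable_fst id] measurable_compose[OF measurable_snd id]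
    by (intro measurable_Pair) auto
  from measurable_compose[OF this[unfolded borel_prod] assms] show ?thesis by simp
qed

lemma AE_unit_interval_iff: "(AE x in \<mu>. P x) \<longleftrightarrow> (AE x in lborel. x \<in> {0..1} \<longrightarrow> P x)"
  by (subst AE_restrict_space_iff) (auto simp: AE_completion_iff)

lemma AE_unit_square_iff:
  "(AE p in lebesgue_on unit_square. P p) \<longleftrightarrow> (AE p in lborel. p \<in> unit_square \<longrightarrow> P p)"
proof -
  have "unit_square \<in> sets (borel :: (real \<times> real) measure)"
    by (intro borel_closed closed_Times closed_atLeastAtMost)
  then show ?thesis
    by (subst AE_restrict_space_iff) (auto simp: AE_completion_iff)
qed

text \<open>The product of the two interval measures is not completed, unlike Lebesgue measure on
  the square. For Borel properties the difference disappears, because Fubini reduces both sides to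
  the same iterated statement over \<open>lborel\<close>.\<close>

lemma AE_unit_square_product:
  assumes "{p. P p} \<in> sets borel"
  shows "(AE p in \<mu> \<Otimes>\<^sub>M \<mu>. P p) \<longleftrightarrow> (AE p in lebesgue_on unit_square. P p)"
proof -
  interpret prob_space \<mu> by (rule prob_space_unit_interval)
  interpret pair_sigma_finite \<mu> \<mu> by standard
  have Pm: "{p \<in> space (\<mu> \<Otimes>\<^sub>M \<mu>). P p} \<in> sets (\<mu> \<Otimes>\<^sub>M \<mu>)"
  proof -
    have "Measurable.pred borel P" using assms by (simp add: pred_def)
    then have "(\<lambda>p. if P p then 1 else 0 :: real) \<in> borel_measurable borel" by measurable
    from borel_measurable_unit_square[OF this]
    have "(\<lambda>p. if P p then 1 else 0 :: real) -` {1} \<inter> space (\<mu> \<Otimes>\<^sub>M \<mu>) \<in> sets (\<mu> \<Otimes>\<^sub>M \<mu>)"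
      by (rule measurable_sets) auto
    also have "(\<lambda>p. if P p then 1 else 0 :: real) -` {1} \<inter> space (\<mu> \<Otimes>\<^sub>M \<mu>) = {p \<in> space (\<mu> \<Otimes>\<^sub>M \<mu>). P p}" by (auto split: if_splits)
    finally show ?thesis .
  qed
  have sq: "unit_square \<in> sets (borel :: (real \<times> real) measure)"
    by (intro borel_closed closed_Times closed_atLeastAtMost)
  have Lm: "{p \<in> space (lborel \<Otimes>\<^sub>M lborel). p \<in> unit_square \<longrightarrow> P p} \<in> sets (lborel \<Otimes>\<^sub>M lborel)"
  proof -
    have "{p. p \<in> unit_square \<longrightarrow> P p} = {p. P p} \<union> - unit_square" by auto
    also have "\<dots> \<in> sets borel" using assms sq by auto
    finally show ?thesis unfolding lborel_prod by simp
  qed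
  have "(AE p in \<mu> \<Otimes>\<^sub>M \<mu>. P p) \<longleftrightarrow> (AE x in \<mu>. AE y in \<mu>. P (x, y))"
    using AE_pair AE_pair_measure[OF Pm] by blast
  also have "\<dots> \<longleftrightarrow> (AE x in lborel. AE y in lborel. (x, y) \<in> unit_square \<longrightarrow> P (x, y))"
    unfolding AE_unit_interval_iff
  proof (intro arg_cong2[where f=eventually] ext refl iffI)
    fix x assume "x \<in> {0..1} \<longrightarrow> (AE y in lborel. y \<in> {0..1} \<longrightarrow> P (x, y))"
    then show "AE y in lborel. (x, y) \<in> unit_square \<longrightarrow> P (x, y)" by (cases "x \<in> {0..1}") auto
  qed (auto elim: eventually_mono)
  also have "\<dots> \<longleftrightarrow> (AE p in lborel \<Otimes>\<^sub>M lborel. p \<in> unit_square \<longrightarrow> P p)"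
    using lborel_pair.AE_pair[of "\<lambda>p. p \<in> unit_square \<longrightarrow> P p"] lborel_pair.AE_pair_measure[OF Lm] by blast
  finally show ?thesis unfolding AE_unit_square_iff lborel_prod .
qed

text \<open>A Borel function composed with a pair of coordinates is measurable in the uncompleted
  product. Clamping to the bound of \<open>f\<close> makes the representative bounded at every point
  of the plane, as the colouring bound demands.\<close>

lemma bounded_measurable_representative:
  assumes "f \<in> bounded_measurable"
  obtains g K where "g \<in> borel_measurable borel" "\<forall>p. \<bar>g p\<bar> \<le> K"
    "AE p in lebesgue_on unit_square. f p = g p"
proof -
  have fm: "f \<in> borel_measurable (lebesgue_on unit_square)" and "bounded (f ` unit_square)"
    using assms by (auto simp: bounded_measurable_def)
  then obtain K where K: "\<And>p. p \<in> unit_square \<Longrightarrow> \<bar>f p\<bar> \<le> K" by (auto simp: bounded_iff)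
  have K0: "0 \<le> K" using K[of "(0,0)"] by auto
  have sq: "unit_square \<in> sets (lebesgue :: (real \<times> real) measure)"
    by (intro sets_completionI_sets) (auto intro!: borel_closed closed_Times closed_atLeastAtMost)
  have "(\<lambda>p. if p \<in> unit_square then f p else 0) \<in> borel_measurable lebesgue"
    using borel_measurable_if[OF sq] fm by blast
  from completion_ex_borel_measurable_real[OF this] obtain h
    where h: "h \<in> borel_measurable lborel" and ae: "AE p in lborel. (if p \<in> unit_square then f p else 0) = h p"
    by blast
  show ?thesis
  proof
    show "(\<lambda>p. max (- K) (min K (h p))) \<in> borel_measurable borel" using h by simp
    show "\<forall>p. \<bar>max (- K) (min K (h p))\<bar> \<le> K" using K0 by auto
    show "AE p in lebesgue_on unit_square. f p = max (- K) (min K (h p))"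
      unfolding AE_unit_square_iff using ae
    proof eventually_elim
      case (elim p)
      then show ?case using K[of p] by (auto simp: abs_le_iff min_def max_def split: if_splits)
    qed
  qed
qed

lemma graph_norm_representative:
  assumes fin: "finite A" "finite B" and E: "E \<subseteq> A \<times> B"
    and g: "g \<in> borel_measurable borel" and ae: "AE p in lebesgue_on unit_square. f p = g p"
  shows "graph_norm A B E f = enn2real (hom_integral \<mu> A B E (\<lambda>p. ennreal \<bar>g p\<bar>)) powr (1 / real (card E))"
proof -
  have finE: "finite E" using fin E finite_subset by blast
  let ?Q = "Pi\<^sub>M (A <+> B) (\<lambda>_. \<mu>)"
  have "AE p in lborel. p \<in> unit_square \<longrightarrow> f p = g p" using ae by (simp add: AE_unit_square_iff)
  \<comment> \<open>The exceptional set is enlarged to a Borel null set, since only Borel properties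
    transfer to the product measure.\<close>
  then obtain N where N: "{p. \<not> (p \<in> unit_square \<longrightarrow> f p = g p)} \<subseteq> N" "N \<in> null_sets lborel"
    by (auto simp: eventually_ae_filter)
  have "AE p in lebesgue_on unit_square. p \<notin> N"
    unfolding AE_unit_square_iff using AE_not_in[OF N(2)] by eventually_elim auto
  moreover have "{p. p \<notin> N} \<in> sets borel" using N(2) by (auto simp: null_sets_def Collect_neg_eq)
  ultimately have "AE p in \<mu> \<Otimes>\<^sub>M \<mu>. p \<notin> N" by (simp add: AE_unit_square_product)
  then have ae2: "AE p in \<mu> \<Otimes>\<^sub>M \<mu>. f p = g p"
    using AE_space by eventually_elim (use N(1) in \<open>auto simp: space_pair_measure space_restrict_space\<close>)
  have "AE x in ?Q. f (x (Inl (fst e)), x (Inr (snd e))) = g (x (Inl (fst e)), x (Inr (snd e)))" if e: "e \<in> E" for e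
  proof -
    have d: "distr ?Q (\<mu> \<Otimes>\<^sub>M \<mu>) (\<lambda>x. (x (Inl (fst e)), x (Inr (snd e)))) = \<mu> \<Otimes>\<^sub>M \<mu>"
      using E e fin by (intro distr_PiM_pair prob_space_unit_interval) auto
    have zm: "(\<lambda>x. (x (Inl (fst e)), x (Inr (snd e)))) \<in> ?Q \<rightarrow>\<^sub>M \<mu> \<Otimes>\<^sub>M \<mu>"
      using E e by (intro measurable_Pair measurable_component_singleton) auto
    show ?thesis by (rule AE_distrD[OF zm]) (unfold d, rule ae2)
  qed
  then have "AE x in ?Q. \<forall>e\<in>E. f (x (Inl (fst e)), x (Inr (snd e))) = g (x (Inl (fst e)), x (Inr (snd e)))"
    using finE by (intro AE_finite_allI) auto
  then have aeQ: "AE x in ?Q. (\<Prod>(a, b)\<in>E. \<bar>f (x (Inl a), x (Inr b))\<bar>) = (\<Prod>(a, b)\<in>E. \<bar>g (x (Inl a), x (Inr b))\<bar>)"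
    by eventually_elim (auto intro!: prod.cong)
  have ga: "(\<lambda>p. ennreal \<bar>g p\<bar>) \<in> borel_measurable (\<mu> \<Otimes>\<^sub>M \<mu>)"
    by (rule borel_measurable_unit_square) (use g in measurable)
  have eq: "(\<Prod>e\<in>E. ennreal \<bar>g (x (Inl (fst e)), x (Inr (snd e)))\<bar>) =
      ennreal (\<Prod>(a, b)\<in>E. \<bar>g (x (Inl a), x (Inr b))\<bar>)" for x
    by (subst prod_ennreal) (auto simp: case_prod_beta)
  have nn: "0 \<le> (\<Prod>(a, b)\<in>E. \<bar>g (x (Inl a), x (Inr b))\<bar>)" for x
    by (intro prod_nonneg) auto
  have "(\<lambda>x. ennreal (\<Prod>(a, b)\<in>E. \<bar>g (x (Inl a), x (Inr b))\<bar>)) \<in> borel_measurable ?Q"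
    using measurable_hom_integrand[OF E, of "\<lambda>_ p. ennreal \<bar>g p\<bar>" \<mu>] ga by (simp add: eq)
  then have "(\<lambda>x. enn2real (ennreal (\<Prod>(a, b)\<in>E. \<bar>g (x (Inl a), x (Inr b))\<bar>))) \<in> borel_measurable ?Q"
    by measurable
  then have gm: "(\<lambda>x. \<Prod>(a, b)\<in>E. \<bar>g (x (Inl a), x (Inr b))\<bar>) \<in> borel_measurable ?Q"
    by (simp add: nn)
  \<comment> \<open>The integrand of \<open>f\<close> inherits measurability in the completion from
    that of \<open>g\<close>, with which it agrees almost everywhere; for \<open>g\<close> the
    completion can then be dropped.\<close>
  have "(\<integral>x. (\<Prod>(a, b)\<in>E. \<bar>f (x (Inl a), x (Inr b))\<bar>) \<partial>completion ?Q) =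
      (\<integral>x. (\<Prod>(a, b)\<in>E. \<bar>g (x (Inl a), x (Inr b))\<bar>) \<partial>completion ?Q)"
    by (intro integral_cong_AE completion.borel_measurable_AE_cong[OF measurable_completion[OF gm]]
        measurable_completion[OF gm] AE_completion aeQ)
  also have "\<dots> = (\<integral>x. (\<Prod>(a, b)\<in>E. \<bar>g (x (Inl a), x (Inr b))\<bar>) \<partial>?Q)"
    by (rule integral_completion[OF gm])
  also have "\<dots> = enn2real (\<integral>\<^sup>+x. ennreal (\<Prod>(a, b)\<in>E. \<bar>g (x (Inl a), x (Inr b))\<bar>) \<partial>?Q)"
    by (rule integral_eq_nn_integral[OF gm]) (simp add: nn)
  also have "\<dots> = enn2real (hom_integral \<mu> A B E (\<lambda>p. ennreal \<bar>g p\<bar>))"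
    unfolding hom_integral_def eq ..
  finally show ?thesis unfolding graph_norm_def by simp
qed

theorem percolating_weakly_norming:
  assumes perc: "percolating A B E e0"
  shows "weakly_norming A B E"
proof -
  note M = prob_space_unit_interval
  have E: "E \<subseteq> A \<times> B" and e0: "e0 \<in> E" and fin: "finite A" "finite B"
    using perc by (auto simp: percolating_def)
  have finE: "finite E" using fin E finite_subset by blast
  define m where "m = card E"
  \<comment> \<open>Without an edge the exponent \<open>1 / real m\<close> would be
    \<open>1 / 0 = 0\<close> and taking the root would not invert the power.\<close>
  have m: "0 < m" using e0 finE by (auto simp: m_def card_gt_0_iff)
  define H where "H g = hom_integral \<mu> A B E (\<lambda>p. ennreal \<bar>g p\<bar>)" for g :: "real \<times> real \<Rightarrow> real"
  have rep: "graph_norm A B E f = enn2real (H g) powr (1 / real m)"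
    if "g \<in> borel_measurable borel" "AE p in lebesgue_on unit_square. f p = g p" for f g
    unfolding H_def m_def by (rule graph_norm_representative[OF fin E that])
  have meas: "(\<lambda>p. ennreal \<bar>g p\<bar>) \<in> borel_measurable (\<mu> \<Otimes>\<^sub>M \<mu>)" if "g \<in> borel_measurable borel" for g
    by (rule borel_measurable_unit_square) (use that in measurable)
  have H_fin: "H g < top" if "\<forall>p. \<bar>g p\<bar> \<le> K" for g K
  proof -
    have "H g \<le> hom_integral \<mu> A B E (\<lambda>_. ennreal K)"
      unfolding H_def by (intro hom_integral_mono ennreal_leI spec[OF that])
    also have "\<dots> < top" by (simp add: hom_integral_const[OF M] power_less_top_ennreal)
    finally show ?thesis .
  qed
  have powr_m: "(x ^ m) powr (1 / real m) = x" if "0 \<le> x" for x :: real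
    using that m by (cases "x = 0") (simp_all add: powr_realpow[symmetric] powr_powr)
  have def_iff: "graph_norm A B E f = 0 \<longleftrightarrow> (AE p in lebesgue_on unit_square. f p = 0)"
    if f: "f \<in> bounded_measurable" for f
  proof -
    obtain g K where g: "g \<in> borel_measurable borel" "\<forall>p. \<bar>g p\<bar> \<le> K"
      and ae: "AE p in lebesgue_on unit_square. f p = g p"
      using bounded_measurable_representative[OF f] .
    have "graph_norm A B E f = 0 \<longleftrightarrow> H g = 0"
      using H_fin[OF g(2)] by (auto simp: rep[OF g(1) ae] enn2real_eq_0_iff)
    also have "\<dots> \<longleftrightarrow> (AE p in \<mu> \<Otimes>\<^sub>M \<mu>. ennreal \<bar>g p\<bar> = 0)"
      unfolding H_def by (rule hom_integral_eq_0_iff[OF M perc meas[OF g(1)], of "ennreal K"])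
        (rule ennreal_leI, rule spec[OF g(2)], simp)
    also have "\<dots> \<longleftrightarrow> (AE p in \<mu> \<Otimes>\<^sub>M \<mu>. g p = 0)" by simp
    also have "\<dots> \<longleftrightarrow> (AE p in lebesgue_on unit_square. g p = 0)"
      by (rule AE_unit_square_product) (use g(1) in measurable)
    also have "\<dots> \<longleftrightarrow> (AE p in lebesgue_on unit_square. f p = 0)"
    proof
      assume "AE p in lebesgue_on unit_square. g p = 0"
      with ae show "AE p in lebesgue_on unit_square. f p = 0" by eventually_elim simp
    next
      assume "AE p in lebesgue_on unit_square. f p = 0"
      with ae show "AE p in lebesgue_on unit_square. g p = 0" by eventually_elim simp
    qed
    finally show ?thesis .
  qed
  have hom: "graph_norm A B E (\<lambda>p. c * f p) = \<bar>c\<bar> * graph_norm A B E f"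
    if f: "f \<in> bounded_measurable" for c f
  proof -
    obtain g K where g: "g \<in> borel_measurable borel" "\<forall>p. \<bar>g p\<bar> \<le> K"
      and ae: "AE p in lebesgue_on unit_square. f p = g p"
      using bounded_measurable_representative[OF f] .
    have "AE p in lebesgue_on unit_square. c * f p = c * g p" using ae by eventually_elim simp
    moreover have "(\<lambda>p. c * g p) \<in> borel_measurable borel" using g(1) by measurable
    ultimately have "graph_norm A B E (\<lambda>p. c * f p) = enn2real (H (\<lambda>p. c * g p)) powr (1 / real m)"
      by (intro rep)
    also have "H (\<lambda>p. c * g p) = ennreal \<bar>c\<bar> ^ m * H g"
      unfolding H_def m_def using hom_integral_cmult[OF E meas[OF g(1)], of "ennreal \<bar>c\<bar>"]
      by (simp add: abs_mult ennreal_mult)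
    also have "enn2real \<dots> = \<bar>c\<bar> ^ m * enn2real (H g)"
      by (simp add: enn2real_mult ennreal_power)
    also have "\<dots> powr (1 / real m) = \<bar>c\<bar> * enn2real (H g) powr (1 / real m)"
      by (simp add: powr_mult powr_m)
    finally show ?thesis by (simp add: rep[OF g(1) ae])
  qed
  have tri: "graph_norm A B E (\<lambda>p. f p + h p) \<le> graph_norm A B E f + graph_norm A B E h"
    if f: "f \<in> bounded_measurable" and h: "h \<in> bounded_measurable" for f h
  proof -
    obtain f' K where f': "f' \<in> borel_measurable borel" "\<forall>p. \<bar>f' p\<bar> \<le> K"
      and fae: "AE p in lebesgue_on unit_square. f p = f' p"
      using bounded_measurable_representative[OF f] .
    obtain h' K' where h': "h' \<in> borel_measurable borel" "\<forall>p. \<bar>h' p\<bar> \<le> K'"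
      and hae: "AE p in lebesgue_on unit_square. h p = h' p"
      using bounded_measurable_representative[OF h] .
    have fin_f: "H f' < top" and fin_h: "H h' < top" using H_fin[OF f'(2)] H_fin[OF h'(2)] .
    have bound: "H g \<le> ennreal a ^ m"
      if "H g < top" "enn2real (H g) powr (1 / real m) \<le> a" for g a
    proof -
      have "0 \<le> a" using that(2) powr_ge_zero order_trans by blast
      have "enn2real (H g) = (enn2real (H g) powr (1 / real m)) ^ m"
        using m by (cases "enn2real (H g) = 0") (simp_all add: powr_realpow[symmetric] powr_powr)
      also have "\<dots> \<le> a ^ m" using that(2) by (intro power_mono) auto
      finally have "ennreal (enn2real (H g)) \<le> ennreal (a ^ m)" by (rule ennreal_leI)
      then show ?thesis using that(1) \<open>0 \<le> a\<close> by (simp add: ennreal_power)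
    qed
    show ?thesis
    proof (rule field_le_epsilon)
      fix \<epsilon> :: real assume \<epsilon>: "0 < \<epsilon>"
      \<comment> \<open>The slack \<open>\<epsilon> / 2\<close> in each bound keeps it strictly
        positive even when the norm is 0.\<close>
      define a where "a = graph_norm A B E f + \<epsilon> / 2"
      define b where "b = graph_norm A B E h + \<epsilon> / 2"
      have ab: "0 < a" "0 < b" using \<epsilon> by (auto simp: a_def b_def graph_norm_def intro!: add_nonneg_pos)
      have "H (\<lambda>p. f' p + h' p) \<le> hom_integral \<mu> A B E (\<lambda>p. ennreal \<bar>f' p\<bar> + ennreal \<bar>h' p\<bar>)"
        unfolding H_def by (intro hom_integral_mono) (simp flip: ennreal_plus add: ennreal_leI)
      also have "\<dots> \<le> (ennreal a + ennreal b) ^ card E"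
      proof (rule hom_integral_add_le[OF M perc meas[OF f'(1)] meas[OF h'(1)], where K="ennreal (max K K')"])
        show "ennreal \<bar>f' p\<bar> \<le> ennreal (max K K')" "ennreal \<bar>h' p\<bar> \<le> ennreal (max K K')" for p
          using spec[OF f'(2), of p] spec[OF h'(2), of p] by (auto intro!: ennreal_leI)
        show "hom_integral \<mu> A B E (\<lambda>p. ennreal \<bar>f' p\<bar>) \<le> ennreal a ^ card E"
          unfolding H_def[symmetric] m_def[symmetric] using \<epsilon>
          by (intro bound fin_f) (simp add: a_def rep[OF f'(1) fae])
        show "hom_integral \<mu> A B E (\<lambda>p. ennreal \<bar>h' p\<bar>) \<le> ennreal b ^ card E"
          unfolding H_def[symmetric] m_def[symmetric] using \<epsilon>
          by (intro bound fin_h) (simp add: b_def rep[OF h'(1) hae])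
      qed (use ab in auto)
      also have "\<dots> = ennreal ((a + b) ^ m)" using ab by (simp add: m_def ennreal_power flip: ennreal_plus)
      finally have "enn2real (H (\<lambda>p. f' p + h' p)) \<le> (a + b) ^ m"
        using ab by (intro enn2real_leI) auto
      then have "enn2real (H (\<lambda>p. f' p + h' p)) powr (1 / real m) \<le> ((a + b) ^ m) powr (1 / real m)"
        by (intro powr_mono2) auto
      also have "\<dots> = a + b" using ab by (intro powr_m) auto
      also have "enn2real (H (\<lambda>p. f' p + h' p)) powr (1 / real m) = graph_norm A B E (\<lambda>p. f p + h p)"
        by (rule rep[symmetric]) (use f'(1) h'(1) fae hae in \<open>auto elim: eventually_elim2\<close>)
      finally show "graph_norm A B E (\<lambda>p. f p + h p) \<le> graph_norm A B E f + graph_norm A B E h + \<epsilon>"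
        by (simp add: a_def b_def)
    qed
  qed
  show ?thesis unfolding weakly_norming_def norm_on_bounded_measurable_def
    using def_iff hom tri by (auto simp: graph_norm_def)
qed

section \<open>Isometries, centroids and faces\<close>

lemma isometry_eq_affine:
  fixes g :: "'a::euclidean_space \<Rightarrow> 'a"
  assumes "\<And>x y. dist (g x) (g y) = dist x y"
  obtains L where "linear L" "inj L" "g = (\<lambda>x. g 0 + L x)"
proof
  have "orthogonal_transformation (\<lambda>x. g x - g 0)"
    unfolding orthogonal_transformation_isometry using assms by (auto simp: dist_norm)
  then show "linear (\<lambda>x. g x - g 0)" "inj (\<lambda>x. g x - g 0)"
    by (simp_all add: orthogonal_transformation_linear orthogonal_transformation_inj)
qed simp

lemma isometry_inj:
  fixes g :: "'a::metric_space \<Rightarrow> 'b::metric_space"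
  assumes "\<And>x y. dist (g x) (g y) = dist x y"
  shows "inj g"
proof (rule injI)
  fix x y assume "g x = g y"
  then have "dist (g x) (g y) = 0" by simp
  then show "x = y" using assms by simp
qed

lemma isometry_image_eq:
  assumes "g = (\<lambda>x. g 0 + L x)"
  shows "g ` S = (+) (g 0) ` (L ` S)"
  by (subst assms) (simp add: image_image)

lemma face_of_isometry_image:
  fixes g :: "'a::euclidean_space \<Rightarrow> 'a"
  assumes "\<And>x y. dist (g x) (g y) = dist x y"
  shows "g ` F face_of g ` S \<longleftrightarrow> F face_of S"
proof -
  obtain L where L: "linear L" "inj L" "g = (\<lambda>x. g 0 + L x)" using isometry_eq_affine[OF assms] .
  show ?thesis
    unfolding isometry_image_eq[OF L(3)] by (simp add: face_of_linear_image L(1,2))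
qed

lemma aff_dim_isometry_image:
  fixes g :: "'a::euclidean_space \<Rightarrow> 'a"
  assumes "\<And>x y. dist (g x) (g y) = dist x y"
  shows "aff_dim (g ` S) = aff_dim S"
proof -
  obtain L where L: "linear L" "inj L" "g = (\<lambda>x. g 0 + L x)" using isometry_eq_affine[OF assms] .
  show ?thesis
    unfolding isometry_image_eq[OF L(3)]
    by (simp add: aff_dim_translation_eq aff_dim_injective_linear_image L(1,2))
qed

lemma extreme_points_of_isometry_image:
  fixes g :: "'a::euclidean_space \<Rightarrow> 'a"
  assumes "\<And>x y. dist (g x) (g y) = dist x y"
  shows "{v. v extreme_point_of g ` S} = g ` {v. v extreme_point_of S}"
proof -
  have "g x extreme_point_of g ` S \<longleftrightarrow> x extreme_point_of S" for x
    using face_of_isometry_image[OF assms, of "{x}" S] by (simp add: face_of_singleton)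
  moreover have "v \<in> g ` S" if "v extreme_point_of g ` S" for v
    using that by (simp add: extreme_point_of_def)
  ultimately show ?thesis by fast
qed

text \<open>The mean of the vertices, not the centre of mass. Isometries commute with it because
  they carry extreme points to extreme points, and its positive weight at every vertex puts it into
  the relative interior.\<close>

definition centroid :: "'a::euclidean_space set \<Rightarrow> 'a" where
  "centroid F = (\<Sum>v | v extreme_point_of F. v /\<^sub>R real (card {v. v extreme_point_of F}))"

lemma extreme_points_polytope:
  fixes F :: "'a::euclidean_space set"
  assumes "polytope F"
  shows "finite {v. v extreme_point_of F}" "F = convex hull {v. v extreme_point_of F}"
  using finite_polyhedron_extreme_points[OF polytope_imp_polyhedron[OF assms]]
    Krein_Milman_Minkowski[OF polytope_imp_compact[OF assms] polytope_imp_convex[OF assms]] by simp_all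

lemma card_extreme_points_pos:
  fixes F :: "'a::euclidean_space set"
  assumes "polytope F" "F \<noteq> {}"
  shows "0 < card {v. v extreme_point_of F}"
proof -
  have "{v. v extreme_point_of F} \<noteq> {}"
    using extreme_points_polytope(2)[OF assms(1)] assms(2) by force
  then show ?thesis using extreme_points_polytope(1)[OF assms(1)] by (simp add: card_gt_0_iff)
qed

lemma centroid_in_rel_interior:
  fixes F :: "'a::euclidean_space set"
  assumes "polytope F" "F \<noteq> {}"
  shows "centroid F \<in> rel_interior F"
proof -
  let ?V = "{v. v extreme_point_of F}"
  have "centroid F \<in> rel_interior (convex hull ?V)"
    using explicit_subset_rel_interior_convex_hull_minimal[OF extreme_points_polytope(1)[OF assms(1)]]
  proof (rule subsetD)
    show "centroid F \<in> {y. \<exists>u. (\<forall>x\<in>?V. 0 < u x) \<and> sum u ?V = 1 \<and> (\<Sum>x\<in>?V. u x *\<^sub>R x) = y}"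
      using card_extreme_points_pos[OF assms]
      by (auto simp: centroid_def intro!: exI[of _ "\<lambda>_. inverse (real (card ?V))"])
  qed
  then show ?thesis using extreme_points_polytope(2)[OF assms(1)] by simp
qed

lemma centroid_isometry_image:
  fixes g :: "'a::euclidean_space \<Rightarrow> 'a"
  assumes g: "\<And>x y. dist (g x) (g y) = dist x y" and F: "polytope F" "F \<noteq> {}"
  shows "centroid (g ` F) = g (centroid F)"
proof -
  obtain L where L: "linear L" "inj L" "g = (\<lambda>x. g 0 + L x)" using isometry_eq_affine[OF g] .
  let ?V = "{v. v extreme_point_of F}"
  have inj: "inj_on g ?V"
    using isometry_inj[OF g] by (rule inj_on_subset) simp
  let ?n = "real (card ?V)"
  have n: "?n \<noteq> 0" using card_extreme_points_pos[OF F] by simp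
  have "centroid (g ` F) = (\<Sum>v\<in>?V. g v /\<^sub>R ?n)"
    unfolding centroid_def extreme_points_of_isometry_image[OF g]
    by (simp add: sum.reindex[OF inj] card_image[OF inj])
  also have "\<dots> = (\<Sum>v\<in>?V. g 0 /\<^sub>R ?n + L (v /\<^sub>R ?n))"
    by (subst L(3)) (simp add: scaleR_right_distrib linear_scale[OF L(1)])
  \<comment> \<open>The weights add up to 1, so the translation part \<open>g 0\<close> survives
    exactly once.\<close>
  also have "\<dots> = g 0 + L (centroid F)"
    using n by (simp add: sum.distrib centroid_def linear_sum[OF L(1)] scaleR_left.sum[symmetric]
        sum_constant_scaleR del: sum_constant)
  also have "\<dots> = g (centroid F)" by (rule fun_cong[OF L(3), symmetric])
  finally show ?thesis .
qed

section \<open>Chains of faces and the barycentric subdivision\<close>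

lemma chain_combination_in_rel_interior:
  fixes c :: "'a::euclidean_space set \<Rightarrow> 'a"
  assumes "finite \<C>" and M: "M \<in> \<C>" "convex M" and sub: "\<And>F. F \<in> \<C> \<Longrightarrow> F \<subseteq> M"
    and c: "\<And>F. F \<in> \<C> \<Longrightarrow> c F \<in> rel_interior F" and l: "\<And>F. F \<in> \<C> \<Longrightarrow> (0::real) < l F"
  shows "(\<Sum>F\<in>\<C>. l F *\<^sub>R c F) /\<^sub>R sum l \<C> \<in> rel_interior M"
proof (cases "\<C> = {M}")
  case True
  with c[OF M(1)] l[OF M(1)] show ?thesis by simp
next
  case False
  let ?R = "\<C> - {M}"
  have R: "finite ?R" "?R \<noteq> {}" using False M(1) assms(1) by auto
  have Rpos: "0 < sum l ?R" using R l by (intro sum_pos) auto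
  have tot: "sum l \<C> = l M + sum l ?R" "(\<Sum>F\<in>\<C>. l F *\<^sub>R c F) = l M *\<^sub>R c M + (\<Sum>F\<in>?R. l F *\<^sub>R c F)"
    using M(1) assms(1) by (simp_all add: sum.remove)
  have lM: "0 < l M" using l M(1) by simp
  \<comment> \<open>\<open>y\<close> is the normalized combination without \<open>M\<close>. The
    full combination lies on the segment from \<open>y \<in> M\<close> to the relative interior
    point \<open>c M\<close> and differs from a bare \<open>y\<close> by a positive share of
    \<open>c M\<close>.\<close>
  define y where "y = (\<Sum>F\<in>?R. (l F / sum l ?R) *\<^sub>R c F)"
  have y: "y \<in> M" unfolding y_def
  proof (rule convex_sum[OF R(1) M(2)])
    show "(\<Sum>F\<in>?R. l F / sum l ?R) = 1" using Rpos by (simp add: sum_divide_distrib[symmetric])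
    show "0 \<le> l F / sum l ?R" if "F \<in> ?R" for F using l that Rpos by (simp add: less_imp_le)
    show "c F \<in> M" if "F \<in> ?R" for F using c sub that rel_interior_subset by blast
  qed
  let ?s = "sum l \<C>"
  have s: "?s \<noteq> 0" using lM Rpos tot by simp
  have Ry: "(\<Sum>F\<in>?R. l F *\<^sub>R c F) = sum l ?R *\<^sub>R y"
    unfolding y_def using Rpos by (simp add: scaleR_sum_right)
  have "y - (l M / ?s) *\<^sub>R (y - c M) \<in> rel_interior M"
    by (rule rel_interior_convex_shrink[OF M(2) c[OF M(1)] y]) (use lM Rpos tot in auto)
  also have "y - (l M / ?s) *\<^sub>R (y - c M) = (1 - l M / ?s) *\<^sub>R y + (l M / ?s) *\<^sub>R c M"
    by (simp add: algebra_simps)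
  also have "1 - l M / ?s = sum l ?R / ?s" using s tot by (simp add: field_simps)
  also have "(sum l ?R / ?s) *\<^sub>R y + (l M / ?s) *\<^sub>R c M = (\<Sum>F\<in>\<C>. l F *\<^sub>R c F) /\<^sub>R ?s"
    unfolding tot(2) Ry by (simp add: scaleR_add_right divide_inverse mult.commute)
  finally show ?thesis .
qed

text \<open>The weights are not normalized: removing a member, or lowering its weight to a smaller
  positive value, must give a weighted chain again. Totals are compared separately.\<close>

definition weighted_chain :: "'a::euclidean_space set \<Rightarrow> 'a set set \<Rightarrow> ('a set \<Rightarrow> real) \<Rightarrow> bool" where
  "weighted_chain P \<C> l \<longleftrightarrow>
     finite \<C> \<and> subset.chain {F. F face_of P \<and> F \<noteq> {}} \<C> \<and> (\<forall>F\<in>\<C>. 0 < l F)"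

lemma weighted_chain_greatest:
  assumes "weighted_chain P \<C> l" "\<C> \<noteq> {}"
  obtains M where "M \<in> \<C>" "\<forall>F\<in>\<C>. F \<subseteq> M"
proof -
  have fin: "finite \<C>" and ch: "\<forall>F\<in>\<C>. \<forall>G\<in>\<C>. F \<subseteq> G \<or> G \<subseteq> F"
    using assms(1) by (auto simp: weighted_chain_def subset.chain_def)
  obtain M where M: "M \<in> \<C>" "\<And>F. F \<in> \<C> \<Longrightarrow> M \<subseteq> F \<Longrightarrow> F = M"
    using finite_has_maximal[OF fin assms(2)] by blast
  show ?thesis
  proof (rule that[OF M(1)], rule ballI)
    fix F assume F: "F \<in> \<C>"
    show "F \<subseteq> M" using bspec[OF bspec[OF ch F] M(1)] M(2)[OF F] by auto
  qed
qed

context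
  fixes P :: "'a::euclidean_space set" and c :: "'a set \<Rightarrow> 'a"
  assumes c: "\<And>F. F face_of P \<Longrightarrow> F \<noteq> {} \<Longrightarrow> c F \<in> rel_interior F"
begin

text \<open>Both normalized sums are the same point. It lies in the relative interiors of
  \<open>M\<close> and \<open>N\<close>, and relative interiors of different faces are
  disjoint.\<close>

lemma weighted_chain_greatest_eq:
  assumes A: "weighted_chain P \<A> u" "M \<in> \<A>" "\<forall>F\<in>\<A>. F \<subseteq> M"
    and B: "weighted_chain P \<B> v" "N \<in> \<B>" "\<forall>F\<in>\<B>. F \<subseteq> N"
    and eq: "sum u \<A> = sum v \<B>" "(\<Sum>F\<in>\<A>. u F *\<^sub>R c F) = (\<Sum>F\<in>\<B>. v F *\<^sub>R c F)"
  shows "M = N"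
proof -
  have faces: "\<forall>F\<in>\<A>. F face_of P \<and> F \<noteq> {}" "\<forall>F\<in>\<B>. F face_of P \<and> F \<noteq> {}"
    using A(1) B(1) by (auto simp: weighted_chain_def subset.chain_def)
  have MN: "M face_of P" "N face_of P" using faces A(2) B(2) by blast+
  have "(\<Sum>F\<in>\<A>. u F *\<^sub>R c F) /\<^sub>R sum u \<A> \<in> rel_interior M"
    using A faces c by (intro chain_combination_in_rel_interior face_of_imp_convex[OF MN(1)])
      (auto simp: weighted_chain_def)
  moreover have "(\<Sum>F\<in>\<B>. v F *\<^sub>R c F) /\<^sub>R sum v \<B> \<in> rel_interior N"
    using B faces c by (intro chain_combination_in_rel_interior face_of_imp_convex[OF MN(2)])
      (auto simp: weighted_chain_def)
  ultimately show ?thesis using eq face_of_eq[OF MN] by auto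
qed

text \<open>If \<open>M\<close> weighed more in \<open>\<B>\<close>, subtracting its share
  \<open>u M\<close> on both sides would delete \<open>M\<close> from one chain and keep it on top
  of the other, although the tops have to agree.\<close>

lemma weighted_chain_weight_le:
  assumes A: "weighted_chain P \<A> u" "M \<in> \<A>" "\<forall>F\<in>\<A>. F \<subseteq> M"
    and B: "weighted_chain P \<B> v" "M \<in> \<B>" "\<forall>F\<in>\<B>. F \<subseteq> M"
    and eq: "sum u \<A> = sum v \<B>" "(\<Sum>F\<in>\<A>. u F *\<^sub>R c F) = (\<Sum>F\<in>\<B>. v F *\<^sub>R c F)"
  shows "v M \<le> u M"
proof (rule ccontr)
  assume "\<not> v M \<le> u M"
  then have lt: "u M < v M" by simp
  have fin: "finite \<A>" "finite \<B>" using A(1) B(1) by (simp_all add: weighted_chain_def)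
  define w where "w = v(M := v M - u M)"
  have w: "sum w \<B> = sum v \<B> - u M" "(\<Sum>F\<in>\<B>. w F *\<^sub>R c F) = (\<Sum>F\<in>\<B>. v F *\<^sub>R c F) - u M *\<^sub>R c M"
    by (simp_all add: w_def sum.remove[OF fin(2) B(2)] algebra_simps)
  have a: "sum u (\<A> - {M}) = sum u \<A> - u M"
    "(\<Sum>F\<in>\<A> - {M}. u F *\<^sub>R c F) = (\<Sum>F\<in>\<A>. u F *\<^sub>R c F) - u M *\<^sub>R c M"
    by (simp_all add: sum.remove[OF fin(1) A(2)])
  have Bw: "weighted_chain P \<B> w" using B(1) lt by (simp add: weighted_chain_def w_def)
  have A': "weighted_chain P (\<A> - {M}) u" using A(1) by (auto simp: weighted_chain_def subset.chain_def)
  \<comment> \<open>The weight left over is positive, so deleting \<open>M\<close> does not exhaust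
    \<open>\<A>\<close> and a greatest member remains to compare with \<open>M\<close>.\<close>
  have "0 < sum w \<B>" using Bw B(2) by (intro sum_pos) (auto simp: weighted_chain_def)
  then have "sum u (\<A> - {M}) \<noteq> 0" using a(1) w(1) eq(1) by simp
  then have "\<A> - {M} \<noteq> {}" by force
  then obtain K where K: "K \<in> \<A> - {M}" "\<forall>F\<in>\<A> - {M}. F \<subseteq> K"
    using weighted_chain_greatest[OF A'] by blast
  have "K = M"
    by (rule weighted_chain_greatest_eq[OF A' K Bw B(2,3)]) (simp_all add: a w eq)
  then show False using K(1) by simp
qed

text \<open>This is the uniqueness of the carrier in the barycentric subdivision: the largest member of the
  chain is the face whose relative interior contains the point, and it can be subtracted.\<close>

lemma weighted_chain_unique:
  assumes "weighted_chain P \<C> l" "weighted_chain P \<D> m"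
    and "sum l \<C> = sum m \<D>" "(\<Sum>F\<in>\<C>. l F *\<^sub>R c F) = (\<Sum>F\<in>\<D>. m F *\<^sub>R c F)"
  shows "\<C> = \<D>"
  using assms
proof (induction "card \<C>" arbitrary: \<C> \<D> rule: less_induct)
  case less
  note C = less.prems(1) and D = less.prems(2) and eqs = less.prems(3,4)
  have fin: "finite \<C>" "finite \<D>" using C D by (simp_all add: weighted_chain_def)
  show ?case
  proof (cases "\<C> = {} \<or> \<D> = {}")
    case True
    have "\<C> = {}" if "\<D> = {}"
      using that eqs(1) C sum_pos[of \<C> l] by (cases "\<C> = {}") (auto simp: weighted_chain_def)
    moreover have "\<D> = {}" if "\<C> = {}"
      using that eqs(1) D sum_pos[of \<D> m] by (cases "\<D> = {}") (auto simp: weighted_chain_def)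
    ultimately show ?thesis using True by blast
  next
    case False
    obtain M where M: "M \<in> \<C>" "\<forall>F\<in>\<C>. F \<subseteq> M" using weighted_chain_greatest[OF C] False by blast
    obtain N where N: "N \<in> \<D>" "\<forall>F\<in>\<D>. F \<subseteq> N" using weighted_chain_greatest[OF D] False by blast
    have MN: "N = M" by (rule weighted_chain_greatest_eq[OF C M D N eqs, symmetric])
    note N = N[unfolded MN]
    have lm: "l M = m M"
      using weighted_chain_weight_le[OF C M D N eqs]
        weighted_chain_weight_le[OF D N C M eqs[symmetric]] by simp
    have "\<C> - {M} = \<D> - {M}"
    proof (rule less.hyps)
      show "card (\<C> - {M}) < card \<C>" by (rule card_Diff1_less[OF fin(1) M(1)])
      show "weighted_chain P (\<C> - {M}) l" "weighted_chain P (\<D> - {M}) m"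
        using C D by (auto simp: weighted_chain_def subset.chain_def)
      show "sum l (\<C> - {M}) = sum m (\<D> - {M})"
        using eqs(1) lm by (simp add: sum.remove[OF fin(1) M(1)] sum.remove[OF fin(2) N(1)])
      show "(\<Sum>F\<in>\<C> - {M}. l F *\<^sub>R c F) = (\<Sum>F\<in>\<D> - {M}. m F *\<^sub>R c F)"
        using eqs(2) lm by (simp add: sum.remove[OF fin(1) M(1)] sum.remove[OF fin(2) N(1)])
    qed
    then show ?thesis using M(1) N(1) by blast
  qed
qed

end

section \<open>Faces between two given faces\<close>

lemma polytope_face_between:
  fixes G :: "'a::euclidean_space set"
  assumes G: "polytope G" and F: "F face_of G" and d: "aff_dim F + 1 < aff_dim G"
  obtains X where "X face_of G" "F \<subseteq> X" "X \<noteq> F" "X \<noteq> G"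
proof (cases "F = {}")
  case True
  with d have "G \<noteq> {}" by auto
  then obtain v where "v extreme_point_of G"
    using card_extreme_points_pos[OF G] by (metis (mono_tags) Collect_empty_eq card.empty less_irrefl)
  then show ?thesis using True d by (intro that[of "{v}"]) (auto simp: face_of_singleton)
next
  case False
  have "F \<noteq> G" using d by auto
  then obtain X where "X facet_of G" "F \<subseteq> X"
    using face_of_polyhedron_subset_facet[OF polytope_imp_polyhedron[OF G] F False] by blast
  then show ?thesis using d by (intro that[of X]) (auto simp: facet_of_def)
qed

text \<open>This is the part of the diamond property that allows a flag to be changed in one face. A
  nonempty \<open>F\<close> is the intersection of the facets of \<open>G\<close> that contain it,
  so there must be more than one. Above the empty face, \<open>G\<close> is one-dimensional and
  cannot be the hull of a single vertex.\<close>

lemma polytope_second_face_between: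
  fixes G :: "'a::euclidean_space set"
  assumes G: "polytope G" and F: "F face_of G" and d: "aff_dim G = aff_dim F + 2"
    and Y: "Y face_of G" "F \<subseteq> Y" "aff_dim Y = aff_dim F + 1"
  obtains X where "X face_of G" "F \<subseteq> X" "aff_dim X = aff_dim F + 1" "X \<noteq> Y"
proof (cases "F = {}")
  case True
  let ?V = "{v. v extreme_point_of G}"
  have "\<exists>v. v extreme_point_of G \<and> {v} \<noteq> Y"
  proof (rule ccontr)
    assume "\<not> ?thesis"
    then have "?V \<subseteq> {v}" if "v \<in> ?V" for v using that by auto
    then have "\<exists>v. ?V \<subseteq> {v}" by blast
    then obtain v where "?V \<subseteq> {v}" ..
    then have "G \<subseteq> {v}" using extreme_points_polytope(2)[OF G] convex_hull_singleton hull_mono by metis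
    then have "aff_dim G \<le> 0" using aff_dim_subset[of G "{v}"] by simp
    with True d show False by simp
  qed
  then obtain v where "v extreme_point_of G" "{v} \<noteq> Y" by blast
  then show ?thesis using True by (intro that[of "{v}"]) (auto simp: face_of_singleton)
next
  case False
  have FG: "F \<noteq> G" using d by auto
  have Yf: "Y facet_of G" using Y d False by (auto simp: facet_of_def)
  have "\<exists>X. X facet_of G \<and> F \<subseteq> X \<and> X \<noteq> Y"
  proof (rule ccontr)
    assume "\<not> ?thesis"
    then have eq: "{X. X facet_of G \<and> F \<subseteq> X} = {Y}" using Yf Y(2) by blast
    have "F = \<Inter>{X. X facet_of G \<and> F \<subseteq> X}"
      by (rule face_of_polyhedron[OF polytope_imp_polyhedron[OF G] F False FG])
    also have "\<dots> = Y" by (simp add: eq)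
    finally have "F = Y" .
    then show False using Y(3) by simp
  qed
  then obtain X where "X facet_of G" "F \<subseteq> X" "X \<noteq> Y" by blast
  then show ?thesis using d by (intro that[of X]) (auto simp: facet_of_def)
qed

section \<open>Reflections and flags of a regular polytope\<close>

text \<open>The hyperplane orthogonal to \<open>a i\<close> contains every \<open>v j\<close> except
  \<open>v i\<close>. This is meant for the walls of a flag and the directions from the centre to
  the centroids of its faces.\<close>

lemma biorthogonal_independent:
  fixes v a :: "'i \<Rightarrow> 'a::euclidean_space"
  assumes orth: "\<And>i j. i \<in> I \<Longrightarrow> j \<in> I \<Longrightarrow> i \<noteq> j \<Longrightarrow> a i \<bullet> v j = 0"
    and pos: "\<And>i. i \<in> I \<Longrightarrow> 0 < a i \<bullet> v i"
  shows "independent (v ` I)" "inj_on v I"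
proof -
  show "inj_on v I"
  proof (rule inj_onI, rule ccontr)
    fix i j assume "i \<in> I" "j \<in> I" "v i = v j" "i \<noteq> j"
    then show False using orth[of i j] pos[of i] by simp
  qed
  show "independent (v ` I)"
    unfolding dependent_def
  proof
    assume "\<exists>x\<in>v ` I. x \<in> span (v ` I - {x})"
    then obtain i where i: "i \<in> I" "v i \<in> span (v ` I - {v i})" by blast
    have "span (v ` I - {v i}) \<subseteq> {x. a i \<bullet> x = 0}"
      by (rule span_minimal[OF _ subspace_hyperplane]) (use orth[OF i(1)] in auto)
    then show False using i pos[OF i(1)] by auto
  qed
qed

section \<open>Reflections in hyperplanes\<close>

definition reflect :: "'a::euclidean_space \<Rightarrow> 'a \<Rightarrow> 'a \<Rightarrow> 'a" where
  "reflect a z x = x - (2 * (a \<bullet> (x - z)) / (a \<bullet> a)) *\<^sub>R a"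

lemma reflect_inner:
  assumes "a \<noteq> 0"
  shows "a \<bullet> (reflect a z x - z) = - (a \<bullet> (x - z))"
  using assms by (simp add: reflect_def inner_diff_right)

lemma reflect_reflect [simp]:
  assumes "a \<noteq> 0"
  shows "reflect a z (reflect a z x) = x"
proof -
  have "reflect a z (reflect a z x) = reflect a z x - (2 * (a \<bullet> (reflect a z x - z)) / (a \<bullet> a)) *\<^sub>R a"
    by (simp add: reflect_def)
  also have "\<dots> = x" unfolding reflect_inner[OF assms] by (simp add: reflect_def)
  finally show ?thesis .
qed

lemma reflect_fixed_iff:
  assumes "a \<noteq> 0"
  shows "reflect a z x = x \<longleftrightarrow> a \<bullet> (x - z) = 0"
  using assms by (auto simp: reflect_def)

lemma reflect_midpoint:
  "reflect a z ((1/2) *\<^sub>R (x + y)) = (1/2) *\<^sub>R (reflect a z x + reflect a z y)"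
proof -
  define s t where "s = 2 * (a \<bullet> (x - z)) / (a \<bullet> a)" and "t = 2 * (a \<bullet> (y - z)) / (a \<bullet> a)"
  have "a \<bullet> ((1/2) *\<^sub>R (x + y) - z) = (a \<bullet> (x - z) + a \<bullet> (y - z)) / 2"
    by (simp add: inner_diff_right inner_add_right field_simps)
  then have "2 * (a \<bullet> ((1/2) *\<^sub>R (x + y) - z)) / (a \<bullet> a) = (s + t) / 2"
    by (simp add: s_def t_def add_divide_distrib)
  moreover have "(1/2) *\<^sub>R (x + y) - ((s + t) / 2) *\<^sub>R a = (1/2) *\<^sub>R ((x - s *\<^sub>R a) + (y - t *\<^sub>R a))"
    by (simp add: algebra_simps add_divide_distrib)
  ultimately show ?thesis by (simp only: reflect_def s_def t_def)
qed

text \<open>The correction term is negative exactly when the mirror strictly separates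
  \<open>x\<close> from \<open>y\<close>. Both the decrease of the rank and the choice of a nearest
  flag rest on this sign.\<close>

lemma norm_reflect_diff:
  assumes "a \<noteq> 0"
  shows "(norm (reflect a z x - y))\<^sup>2 = (norm (x - y))\<^sup>2 + 4 * (a \<bullet> (x - z)) * (a \<bullet> (y - z)) / (a \<bullet> a)"
proof -
  define t where "t = (a \<bullet> (x - z)) / (a \<bullet> a)"
  have t: "t * (a \<bullet> a) = a \<bullet> (x - z)" using assms by (simp add: t_def)
  have "reflect a z x - y = (x - y) - (2 * t) *\<^sub>R a" by (simp add: reflect_def t_def)
  moreover have "(norm (u - (2 * t) *\<^sub>R a))\<^sup>2 = (norm u)\<^sup>2 - 4 * t * (a \<bullet> u) + 4 * t * (t * (a \<bullet> a))" for u
    by (simp add: power2_norm_eq_inner inner_diff_left inner_diff_right inner_commute algebra_simps)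
  ultimately have "(norm (reflect a z x - y))\<^sup>2 = (norm (x - y))\<^sup>2 - 4 * t * (a \<bullet> (x - y)) + 4 * t * (t * (a \<bullet> a))"
    by (simp only:)
  also have "\<dots> = (norm (x - y))\<^sup>2 + 4 * t * (a \<bullet> (y - z))"
    unfolding t by (simp add: inner_diff_right algebra_simps)
  finally show ?thesis by (simp add: t_def)
qed

text \<open>\<open>norm_reflect_diff\<close> is applied once in each argument; the two correction
  terms cancel because reflecting \<open>y\<close> changes the sign of its height.\<close>

lemma reflect_isometry:
  assumes "a \<noteq> 0"
  shows "dist (reflect a z x) (reflect a z y) = dist x y"
proof -
  have "(norm (reflect a z x - reflect a z y))\<^sup>2 = (norm (reflect a z y - x))\<^sup>2
      + 4 * (a \<bullet> (x - z)) * (a \<bullet> (reflect a z y - z)) / (a \<bullet> a)"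
    unfolding norm_reflect_diff[OF assms, of z x] by (simp add: norm_minus_commute)
  also have "\<dots> = (norm (x - y))\<^sup>2"
    unfolding reflect_inner[OF assms] norm_reflect_diff[OF assms, of z y]
    by (simp add: norm_minus_commute)
  finally show ?thesis by (simp add: dist_norm)
qed

text \<open>Both maps are affine, so agreement at \<open>z\<close> and at each \<open>z + b\<close>
  extends to \<open>z + span B\<close>. Beyond this flat they may differ, since a symmetry can move
  the directions orthogonal to the polytope.\<close>

lemma reflect_eq_isometry:
  fixes g :: "'a::euclidean_space \<Rightarrow> 'a"
  assumes g: "\<And>x y. dist (g x) (g y) = dist x y" and a: "a \<noteq> 0"
    and z: "reflect a z z = g z" and B: "\<And>b. b \<in> B \<Longrightarrow> reflect a z (z + b) = g (z + b)"
    and x: "x - z \<in> span B"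
  shows "reflect a z x = g x"
proof -
  obtain L where L: "linear L" "inj L" "g = (\<lambda>x. g 0 + L x)" using isometry_eq_affine[OF g] .
  obtain K where K: "linear K" "inj K" "reflect a z = (\<lambda>x. reflect a z 0 + K x)"
    using isometry_eq_affine[OF reflect_isometry[OF a]] .
  have gz: "g (z + b) = g z + L b" for b
    using fun_cong[OF L(3), of "z + b"] fun_cong[OF L(3), of z] by (simp only: linear_add[OF L(1)] add.assoc)
  have rz: "reflect a z (z + b) = reflect a z z + K b" for b
    using fun_cong[OF K(3), of "z + b"] fun_cong[OF K(3), of z] by (simp only: linear_add[OF K(1)] add.assoc)
  have "K b = L b" if "b \<in> B" for b using B[OF that] z unfolding gz rz by simp
  then have "K (x - z) = L (x - z)" using linear_eq_on_span[OF K(1) L(1)] x by blast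
  then show ?thesis using gz[of "x - z"] rz[of "x - z"] z by simp
qed

section \<open>Flags of a polytope\<close>

lemma subset_chain_iff:
  "subset.chain A C \<longleftrightarrow> C \<subseteq> A \<and> (\<forall>F\<in>C. \<forall>G\<in>C. F \<subseteq> G \<or> G \<subseteq> F)"
  by (simp add: subset.chain_def subset_iff_psubset_eq)

lemma flag_of_iff:
  "flag_of C P \<longleftrightarrow> (\<forall>F\<in>C. F face_of P) \<and> (\<forall>F\<in>C. \<forall>G\<in>C. F \<subseteq> G \<or> G \<subseteq> F) \<and>
     (\<forall>X. X face_of P \<longrightarrow> (\<forall>F\<in>C. F \<subseteq> X \<or> X \<subseteq> F) \<longrightarrow> X \<in> C)"
proof
  assume f: "flag_of C P"
  then have ch: "subset.chain {F. F face_of P} C" and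
    max: "\<And>S. subset.chain {F. F face_of P} S \<Longrightarrow> \<not> C \<subset> S"
    unfolding flag_of_def subset.maxchain_def by blast+
  have faces: "\<forall>F\<in>C. F face_of P" and tot: "\<forall>F\<in>C. \<forall>G\<in>C. F \<subseteq> G \<or> G \<subseteq> F"
    using ch unfolding subset_chain_iff by blast+
  have "X \<in> C" if "X face_of P" "\<forall>F\<in>C. F \<subseteq> X \<or> X \<subseteq> F" for X
  proof (rule ccontr)
    assume "X \<notin> C"
    moreover have "subset.chain {F. F face_of P} (insert X C)"
      unfolding subset_chain_iff using that faces tot by blast
    ultimately show False using max[of "insert X C"] by blast
  qed
  with faces tot show "(\<forall>F\<in>C. F face_of P) \<and> (\<forall>F\<in>C. \<forall>G\<in>C. F \<subseteq> G \<or> G \<subseteq> F) \<and>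
     (\<forall>X. X face_of P \<longrightarrow> (\<forall>F\<in>C. F \<subseteq> X \<or> X \<subseteq> F) \<longrightarrow> X \<in> C)" by blast
next
  assume r: "(\<forall>F\<in>C. F face_of P) \<and> (\<forall>F\<in>C. \<forall>G\<in>C. F \<subseteq> G \<or> G \<subseteq> F) \<and>
     (\<forall>X. X face_of P \<longrightarrow> (\<forall>F\<in>C. F \<subseteq> X \<or> X \<subseteq> F) \<longrightarrow> X \<in> C)"
  then have "subset.chain {F. F face_of P} C" by (simp add: subset_chain_iff subset_iff)
  moreover have "S \<subseteq> C" if S: "subset.chain {F. F face_of P} S" "C \<subseteq> S" for S
  proof
    fix X assume X: "X \<in> S"
    have "\<forall>F\<in>C. F \<subseteq> X \<or> X \<subseteq> F"
    proof
      fix F assume "F \<in> C"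
      then have "F \<in> S" using S(2) by blast
      then show "F \<subseteq> X \<or> X \<subseteq> F" using subset.chain_total[OF S(1) _ X] by blast
    qed
    moreover have "X face_of P" using S(1) X unfolding subset_chain_iff by blast
    ultimately show "X \<in> C" using r by blast
  qed
  ultimately show "flag_of C P" unfolding flag_of_def subset.maxchain_def by blast
qed

locale nonempty_polytope =
  fixes P :: "'a::euclidean_space set"
  assumes polytope: "polytope P" and nonempty: "P \<noteq> {}"
begin

lemma finite_faces: "finite {F. F face_of P}"
  by (rule finite_polytope_faces[OF polytope])

lemma face_polytope: "F face_of P \<Longrightarrow> polytope F"
  by (rule face_of_polytope_polytope[OF polytope])

lemma face_convex: "F face_of P \<Longrightarrow> convex F"
  by (rule face_of_imp_convex)

lemma finite_flag: "flag_of C P \<Longrightarrow> finite C"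
  using finite_faces by (rule rev_finite_subset) (auto simp: flag_of_iff)

lemma flag_face: "flag_of C P \<Longrightarrow> F \<in> C \<Longrightarrow> F face_of P"
  by (simp add: flag_of_iff)

lemma flag_total: "flag_of C P \<Longrightarrow> F \<in> C \<Longrightarrow> G \<in> C \<Longrightarrow> F \<subseteq> G \<or> G \<subseteq> F"
  by (simp add: flag_of_iff)

lemma flag_maximal: "flag_of C P \<Longrightarrow> X face_of P \<Longrightarrow> (\<And>F. F \<in> C \<Longrightarrow> F \<subseteq> X \<or> X \<subseteq> F) \<Longrightarrow> X \<in> C"
  by (simp add: flag_of_iff)

lemma empty_in_flag: "flag_of C P \<Longrightarrow> {} \<in> C"
  by (rule flag_maximal) auto

lemma polytope_in_flag: "flag_of C P \<Longrightarrow> P \<in> C"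
  by (rule flag_maximal)
    (auto simp: face_of_refl polytope_imp_convex polytope dest: flag_face face_of_imp_subset)

lemma subface_aff_dim_less:
  assumes "F face_of P" "G face_of P" "F \<subseteq> G" "F \<noteq> G"
  shows "aff_dim F < aff_dim G"
  using assms face_of_face[OF assms(2)] by (intro face_of_aff_dim_lt face_convex) auto

lemma comparable_faces_aff_dim:
  assumes "F face_of P" "G face_of P" "F \<subseteq> G \<or> G \<subseteq> F" "aff_dim F \<le> aff_dim G"
  shows "F \<subseteq> G"
  using subface_aff_dim_less[of G F] assms by (cases "F = G") auto

lemma comparable_faces_eq:
  assumes "F face_of P" "G face_of P" "F \<subseteq> G \<or> G \<subseteq> F" "aff_dim F = aff_dim G"
  shows "F = G"
  using comparable_faces_aff_dim[of F G] comparable_faces_aff_dim[of G F] assms by auto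

lemma flag_eqI:
  assumes "flag_of C P" "F \<in> C" "G \<in> C" "aff_dim F = aff_dim G"
  shows "F = G"
  by (rule comparable_faces_eq[OF flag_face[OF assms(1,2)] flag_face[OF assms(1,3)]
        flag_total[OF assms(1-3)] assms(4)])

lemma flag_subsetI:
  assumes "flag_of C P" "F \<in> C" "G \<in> C" "aff_dim F \<le> aff_dim G"
  shows "F \<subseteq> G"
  by (rule comparable_faces_aff_dim[OF flag_face[OF assms(1,2)] flag_face[OF assms(1,3)]
        flag_total[OF assms(1-3)] assms(4)])

lemma flag_extension:
  assumes "\<forall>F\<in>S. F face_of P" "\<forall>F\<in>S. \<forall>G\<in>S. F \<subseteq> G \<or> G \<subseteq> F"
  obtains C where "flag_of C P" "S \<subseteq> C"
proof -
  let ?T = "{C. S \<subseteq> C \<and> subset.chain {F. F face_of P} C}"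
  have "finite ?T"
    by (rule finite_subset[of _ "Pow {F. F face_of P}"]) (auto simp: finite_faces subset_chain_iff)
  moreover have "S \<in> ?T" using assms by (simp add: subset_chain_iff subset_iff)
  ultimately obtain C where C: "C \<in> ?T" "\<And>D. D \<in> ?T \<Longrightarrow> C \<subseteq> D \<Longrightarrow> D = C"
    using finite_has_maximal[of ?T] by (metis (no_types, lifting) empty_iff)
  have "flag_of C P" unfolding flag_of_def subset.maxchain_def
    using C by blast
  then show ?thesis using C(1) that by blast
qed

text \<open>Around a missing dimension, the members just below and just above leave a gap of at
  least two dimensions. A face strictly between them is comparable with the whole flag, so
  maximality makes it a member, against the choice of the two neighbours.\<close>

lemma flag_has_dim:
  assumes C: "flag_of C P" and i: "-1 \<le> i" "i \<le> aff_dim P"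
  obtains F where "F \<in> C" "aff_dim F = i"
proof -
  have "\<exists>F\<in>C. aff_dim F = i"
  proof (rule ccontr)
    assume none: "\<not> ?thesis"
    let ?lo = "{F\<in>C. aff_dim F < i}" and ?hi = "{F\<in>C. i < aff_dim F}"
    have fin: "finite ?lo" "finite ?hi" using finite_flag[OF C] by auto
    have "aff_dim ({}::'a set) \<noteq> i" "aff_dim P \<noteq> i"
      using none empty_in_flag[OF C] polytope_in_flag[OF C] by blast+
    then have "{} \<in> ?lo" "P \<in> ?hi" using empty_in_flag[OF C] polytope_in_flag[OF C] i by auto
    then have ne: "?lo \<noteq> {}" "?hi \<noteq> {}" by blast+
    define F where "F = arg_min_on (\<lambda>X. - aff_dim X) ?lo"
    define G where "G = arg_min_on aff_dim ?hi"
    have F: "F \<in> C" "aff_dim F < i" "\<And>X. X \<in> C \<Longrightarrow> aff_dim X < i \<Longrightarrow> aff_dim X \<le> aff_dim F"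
      using arg_min_if_finite[OF fin(1) ne(1), of "\<lambda>X. - aff_dim X"] unfolding F_def[symmetric] by (auto simp: not_less)
    have G: "G \<in> C" "i < aff_dim G" "\<And>X. X \<in> C \<Longrightarrow> i < aff_dim X \<Longrightarrow> aff_dim G \<le> aff_dim X"
      using arg_min_if_finite[OF fin(2) ne(2), of aff_dim] unfolding G_def[symmetric] by (auto simp: not_less)
    have FG: "F \<subseteq> G" using F G by (intro flag_subsetI[OF C]) auto
    have faces: "F face_of P" "G face_of P" using C F(1) G(1) by (auto intro: flag_face)
    have "F face_of G" using face_of_face[OF faces(2)] faces(1) FG by blast
    then obtain X where X: "X face_of G" "F \<subseteq> X" "X \<noteq> F" "X \<noteq> G"
      using polytope_face_between[OF face_polytope[OF faces(2)]] F(2) G(2) by (metis add1_zle_eq le_less_trans)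
    have XG: "X \<subseteq> G" using X(1) by (rule face_of_imp_subset)
    have XP: "X face_of P" using face_of_trans[OF X(1) faces(2)] .
    have "X \<in> C"
    proof (rule flag_maximal[OF C XP])
      fix Y assume Y: "Y \<in> C"
      then have "aff_dim Y \<noteq> i" using none by blast
      then consider "aff_dim Y \<le> aff_dim F" | "aff_dim G \<le> aff_dim Y"
        using F(3)[OF Y] G(3)[OF Y] by linarith
      then show "Y \<subseteq> X \<or> X \<subseteq> Y"
      proof cases
        case 1 then show ?thesis using flag_subsetI[OF C Y F(1)] X(2) by blast
      next
        case 2 then show ?thesis using flag_subsetI[OF C G(1) Y] XG by blast
      qed
    qed
    moreover have "aff_dim F < aff_dim X" "aff_dim X < aff_dim G"
      using subface_aff_dim_less[OF faces(1) XP X(2)] subface_aff_dim_less[OF XP faces(2) XG] X(3,4) by auto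
    moreover have "aff_dim X \<noteq> i" using none \<open>X \<in> C\<close> by blast
    ultimately show False using F(3)[of X] G(3)[of X] by linarith
  qed
  then show ?thesis using that by blast
qed

lemma flag_ofI:
  assumes faces: "\<forall>F\<in>C. F face_of P" and tot: "\<forall>F\<in>C. \<forall>G\<in>C. F \<subseteq> G \<or> G \<subseteq> F"
    and dims: "\<And>i. -1 \<le> i \<Longrightarrow> i \<le> aff_dim P \<Longrightarrow> \<exists>F\<in>C. aff_dim F = i"
  shows "flag_of C P"
  unfolding flag_of_iff
proof (intro conjI faces tot allI impI)
  fix X assume X: "X face_of P" "\<forall>F\<in>C. F \<subseteq> X \<or> X \<subseteq> F"
  obtain F where F: "F \<in> C" "aff_dim F = aff_dim X"
    using dims[of "aff_dim X"] aff_dim_subset[OF face_of_imp_subset[OF X(1)]] aff_dim_geq[of X] by auto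
  then have "F = X" using X faces by (intro comparable_faces_eq) auto
  then show "X \<in> C" using F by simp
qed

lemma face_aff_dim_bounds:
  assumes "X face_of P" "X \<noteq> {}" "X \<noteq> P"
  shows "0 \<le> aff_dim X" "aff_dim X < aff_dim P"
proof -
  show "0 \<le> aff_dim X" using assms(2) aff_dim_geq[of X] aff_dim_empty[of X] by linarith
  show "aff_dim X < aff_dim P"
    by (rule face_of_aff_dim_lt[OF polytope_imp_convex[OF polytope] assms(1,3)])
qed

text \<open>\<open>X\<close> is replaced by a second face between its neighbours \<open>Y\<close>
  and \<open>Z\<close>, one dimension below and one above. Every other member lies below
  \<open>Y\<close> or above \<open>Z\<close> and so stays comparable.\<close>

lemma flag_exchange:
  assumes C: "flag_of C P" and X: "X \<in> C" "X \<noteq> {}" "X \<noteq> P"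
  obtains X' where "X' \<noteq> X" "X' \<noteq> {}" "aff_dim X' = aff_dim X" "flag_of (insert X' (C - {X})) P"
proof -
  let ?i = "aff_dim X"
  have Xf: "X face_of P" using C X(1) by (rule flag_face)
  have i: "0 \<le> ?i" "?i < aff_dim P" using face_aff_dim_bounds[OF Xf X(2,3)] by auto
  obtain Y where Y: "Y \<in> C" "aff_dim Y = ?i - 1" using flag_has_dim[OF C, of "?i - 1"] i by auto
  obtain Z where Z: "Z \<in> C" "aff_dim Z = ?i + 1" using flag_has_dim[OF C, of "?i + 1"] i by auto
  have sub: "Y \<subseteq> X" "X \<subseteq> Z" "Y \<subseteq> Z"
    using flag_subsetI[OF C Y(1) X(1)] flag_subsetI[OF C X(1) Z(1)] Y(2) Z(2) by auto
  have faces: "Y face_of P" "Z face_of P" using C Y(1) Z(1) by (auto intro: flag_face)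
  have YZ: "Y face_of Z" and XZ: "X face_of Z" using face_of_face[OF faces(2)] faces(1) Xf sub by auto
  have d: "aff_dim Z = aff_dim Y + 2" "aff_dim X = aff_dim Y + 1" using Y(2) Z(2) by auto
  obtain X' where X': "X' face_of Z" "Y \<subseteq> X'" "aff_dim X' = ?i" "X' \<noteq> X"
    using polytope_second_face_between[OF face_polytope[OF faces(2)] YZ d(1) XZ sub(1) d(2)]
    unfolding d(2) by blast
  have X'Z: "X' \<subseteq> Z" using X'(1) by (rule face_of_imp_subset)
  have X'P: "X' face_of P" using face_of_trans[OF X'(1) faces(2)] .
  have cmp: "F \<subseteq> X' \<or> X' \<subseteq> F" if F: "F \<in> C - {X}" for F
  proof -
    have "aff_dim F \<noteq> ?i" using flag_eqI[OF C, of F X] F X(1) by auto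
    then consider "aff_dim F \<le> aff_dim Y" | "aff_dim Z \<le> aff_dim F" using Y(2) Z(2) by linarith
    then show ?thesis
    proof cases
      case 1 then show ?thesis using flag_subsetI[OF C _ Y(1), of F] F X'(2) by blast
    next
      case 2 then show ?thesis using flag_subsetI[OF C Z(1), of F] F X'Z by blast
    qed
  qed
  have "flag_of (insert X' (C - {X})) P"
  proof (rule flag_ofI)
    show "\<forall>F\<in>insert X' (C - {X}). F face_of P" using X'P flag_face[OF C] by blast
    show "\<forall>F\<in>insert X' (C - {X}). \<forall>G\<in>insert X' (C - {X}). F \<subseteq> G \<or> G \<subseteq> F"
      using cmp flag_total[OF C] by blast
    fix j assume j: "-1 \<le> j" "j \<le> aff_dim P"
    obtain F where F: "F \<in> C" "aff_dim F = j" using flag_has_dim[OF C j] .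
    show "\<exists>F\<in>insert X' (C - {X}). aff_dim F = j"
      using F X'(3) by (cases "F = X") auto
  qed
  moreover have "X' \<noteq> {}" using X'(3) i(1) by auto
  ultimately show ?thesis using that X' by blast
qed

end

section \<open>Symmetries acting on centroids and flags\<close>

context nonempty_polytope
begin

abbreviation center :: 'a where "center \<equiv> centroid P"

text \<open>Every symmetry fixes \<open>center\<close>, so placing the empty face there keeps
  \<open>pos\<close> equivariant and puts both improper faces on every mirror through
  \<open>center\<close>.\<close>

definition pos :: "'a set \<Rightarrow> 'a" where
  "pos F = (if F = {} then center else centroid F)"

lemma pos_empty [simp]: "pos {} = center" and pos_polytope [simp]: "pos P = center"
  by (simp_all add: pos_def)

lemma pos_in_rel_interior: "F face_of P \<Longrightarrow> F \<noteq> {} \<Longrightarrow> pos F \<in> rel_interior F"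
  by (simp add: pos_def centroid_in_rel_interior face_polytope)

lemma pos_in_polytope: "F face_of P \<Longrightarrow> pos F \<in> P"
  using pos_in_rel_interior[of F] pos_in_rel_interior[of P] rel_interior_subset face_of_imp_subset[of F P]
    nonempty face_of_refl[OF polytope_imp_convex[OF polytope]]
  by (cases "F = {}") auto

lemma pos_inj:
  assumes "F face_of P" "G face_of P" "F \<noteq> {}" "G \<noteq> {}" "pos F = pos G"
  shows "F = G"
  using face_of_eq[OF assms(1,2)] pos_in_rel_interior[OF assms(1,3)] pos_in_rel_interior[OF assms(2,4)]
    assms(5) by auto

lemma symmetry_dist: "symmetry_of g P \<Longrightarrow> dist (g x) (g y) = dist x y"
  by (simp add: symmetry_of_def)

lemma symmetry_face: "symmetry_of g P \<Longrightarrow> F face_of P \<Longrightarrow> g ` F face_of P"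
  using face_of_isometry_image[of g F P] by (simp add: symmetry_of_def)

lemma symmetry_aff_dim: "symmetry_of g P \<Longrightarrow> aff_dim (g ` F) = aff_dim F"
  by (rule aff_dim_isometry_image) (rule symmetry_dist)

lemma symmetry_pos:
  assumes g: "symmetry_of g P" and F: "F face_of P"
  shows "pos (g ` F) = g (pos F)"
proof (cases "F = {}")
  case True
  have "centroid (g ` P) = g center"
    by (rule centroid_isometry_image[OF symmetry_dist[OF g] polytope nonempty])
  with True g show ?thesis by (simp add: symmetry_of_def)
next
  case False
  then show ?thesis
    using centroid_isometry_image[OF symmetry_dist[OF g] face_polytope[OF F]] by (simp add: pos_def)
qed

lemma symmetry_center: "symmetry_of g P \<Longrightarrow> g center = center"
  using symmetry_pos[of g "{}"] by simp

text \<open>Distinct nonempty faces have distinct centroids. For a reflection this yields what a cut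
  involution demands: a face positioned on the mirror is mapped to itself.\<close>

lemma symmetry_fixes_face_iff:
  assumes g: "symmetry_of g P" and F: "F face_of P"
  shows "g ` F = F \<longleftrightarrow> g (pos F) = pos F"
proof
  assume "g ` F = F" then show "g (pos F) = pos F" using symmetry_pos[OF g F] by simp
next
  assume "g (pos F) = pos F"
  then show "g ` F = F"
    using pos_inj[OF symmetry_face[OF g F] F] symmetry_pos[OF g F] by (cases "F = {}") auto
qed

lemma flag_symmetry_image:
  assumes g: "symmetry_of g P" and C: "flag_of C P"
  shows "flag_of ((`) g ` C) P"
proof (rule flag_ofI)
  show "\<forall>F\<in>(`) g ` C. F face_of P" using symmetry_face[OF g] flag_face[OF C] by blast
  show "\<forall>F\<in>(`) g ` C. \<forall>G\<in>(`) g ` C. F \<subseteq> G \<or> G \<subseteq> F"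
  proof (intro ballI)
    fix F G assume "F \<in> (`) g ` C" "G \<in> (`) g ` C"
    then obtain F' G' where "F' \<in> C" "G' \<in> C" "F = g ` F'" "G = g ` G'" by blast
    then show "F \<subseteq> G \<or> G \<subseteq> F" using flag_total[OF C, of F' G'] image_mono by metis
  qed
  fix i assume "-1 \<le> i" "i \<le> aff_dim P"
  then obtain F where "F \<in> C" "aff_dim F = i" using flag_has_dim[OF C] by blast
  then show "\<exists>F\<in>(`) g ` C. aff_dim F = i" using symmetry_aff_dim[OF g] by blast
qed

text \<open>Were the centroids strictly on opposite sides, the segment between them would meet the
  mirror in a relative interior point of the larger face. That point is fixed, so the face shares it
  with its image and equals that image; but then its centroid lies on the mirror.\<close>

lemma reflect_symmetry_cut:
  assumes a: "a \<noteq> 0" and s: "symmetry_of (reflect a center) P"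
    and F: "F face_of P" and G: "G face_of P" and FG: "F \<subseteq> G"
  shows "0 \<le> (a \<bullet> (pos F - center)) * (a \<bullet> (pos G - center))"
proof (rule ccontr)
  let ?r = "a \<bullet> (pos F - center)" and ?s = "a \<bullet> (pos G - center)"
  assume "\<not> 0 \<le> ?r * ?s"
  then have neg: "?r * ?s < 0" by simp
  then have "F \<noteq> {}" by auto
  then have G0: "G \<noteq> {}" using FG by auto
  \<comment> \<open>The parameter at which the segment from \<open>pos F\<close> to
    \<open>pos G\<close> crosses the mirror.\<close>
  define e where "e = ?r / (?r - ?s)"
  have e: "0 < e" "e \<le> 1" "?r - e * (?r - ?s) = 0"
    using neg by (auto simp: e_def mult_less_0_iff divide_simps)
  have "pos F \<in> G" using pos_in_rel_interior[OF F \<open>F \<noteq> {}\<close>] rel_interior_subset FG by blast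
  define y where "y = pos F - e *\<^sub>R (pos F - pos G)"
  have y: "y \<in> rel_interior G"
    unfolding y_def by (rule rel_interior_convex_shrink[OF face_convex[OF G] pos_in_rel_interior[OF G G0]]) fact+
  have "a \<bullet> (y - center) = ?r - e * (?r - ?s)"
    by (simp add: y_def inner_diff_right algebra_simps)
  then have "reflect a center y = y" using a e(3) by (simp add: reflect_fixed_iff)
  then have "y \<in> reflect a center ` G" using y rel_interior_subset by (metis imageI subsetD)
  then have "G \<subseteq> reflect a center ` G"
    using y by (intro subset_of_face_of[OF symmetry_face[OF s G] face_of_imp_subset[OF G]]) auto
  then have "G = reflect a center ` G"
    using comparable_faces_eq[OF G symmetry_face[OF s G]] symmetry_aff_dim[OF s] by auto
  then have "reflect a center (pos G) = pos G" using symmetry_fixes_face_iff[OF s G] by simp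
  then have "?s = 0" using a by (simp add: reflect_fixed_iff)
  with neg show False by simp
qed

text \<open>A point inside the cone at \<open>center\<close> spanned by the centroids of the flag;
  the improper faces contribute 0. It may lie outside \<open>P\<close>, as it is only compared with
  mirrors through \<open>center\<close> and used to measure distances.\<close>

definition flag_point :: "'a set set \<Rightarrow> 'a" where
  "flag_point C = center + (\<Sum>X\<in>C. pos X - center)"

lemma flag_point_symmetry_image:
  assumes g: "symmetry_of g P" and C: "flag_of C P"
  shows "flag_point ((`) g ` C) = g (flag_point C)"
proof -
  obtain L where L: "linear L" "inj L" "g = (\<lambda>x. g 0 + L x)"
    using isometry_eq_affine[OF symmetry_dist[OF g]] .
  have gd: "g x - g y = L (x - y)" for x y
    using fun_cong[OF L(3), of x] fun_cong[OF L(3), of y] by (simp only: linear_diff[OF L(1)]) simp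
  have "inj g" by (rule isometry_inj[OF symmetry_dist[OF g]])
  then have inj: "inj_on ((`) g) C" by (simp add: inj_image_eq_iff inj_on_def)
  have "flag_point ((`) g ` C) = center + (\<Sum>X\<in>C. pos (g ` X) - center)"
    unfolding flag_point_def by (simp add: sum.reindex[OF inj])
  also have "(\<Sum>X\<in>C. pos (g ` X) - center) = (\<Sum>X\<in>C. L (pos X - center))"
  proof (rule sum.cong[OF refl])
    fix X assume "X \<in> C"
    then show "pos (g ` X) - center = L (pos X - center)"
      using symmetry_pos[OF g flag_face[OF C]] symmetry_center[OF g] gd[of "pos X" center] by simp
  qed
  also have "\<dots> = L (flag_point C - center)"
    by (simp add: flag_point_def linear_sum[OF L(1)])
  also have "\<dots> = g (flag_point C) - center"
    using gd[of "flag_point C" center] symmetry_center[OF g] by simp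
  finally show ?thesis by simp
qed

abbreviation proper :: "'a set set \<Rightarrow> 'a set set" where
  "proper C \<equiv> {X \<in> C. X \<noteq> {} \<and> X \<noteq> P}"

lemma sum_proper:
  assumes "flag_of C P"
  shows "(\<Sum>X\<in>C. pos X - center) = (\<Sum>X\<in>proper C. pos X - center)"
  using finite_flag[OF assms] by (intro sum.mono_neutral_right) auto

lemma card_proper:
  assumes C: "flag_of C P"
  shows "int (card (proper C)) = aff_dim P"
proof -
  have "bij_betw aff_dim (proper C) {0..<aff_dim P}"
  proof (rule bij_betwI')
    show "aff_dim X = aff_dim Y \<longleftrightarrow> X = Y" if "X \<in> proper C" "Y \<in> proper C" for X Y
      using flag_eqI[OF C, of X Y] that by auto
    show "aff_dim X \<in> {0..<aff_dim P}" if "X \<in> proper C" for X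
      using face_aff_dim_bounds[of X] flag_face[OF C, of X] that by auto
    show "\<exists>X\<in>proper C. i = aff_dim X" if i: "i \<in> {0..<aff_dim P}" for i
    proof -
      obtain X where "X \<in> C" "aff_dim X = i" using flag_has_dim[OF C, of i] i by auto
      then show ?thesis using i by (intro bexI[of _ X]) auto
    qed
  qed
  then have "card (proper C) = card {0..<aff_dim P}" by (rule bij_betw_same_card)
  moreover have "0 \<le> aff_dim P" using nonempty aff_dim_geq[of P] aff_dim_empty[of P] by linarith
  ultimately show ?thesis by simp
qed

text \<open>The wall normals \<open>a X\<close> read off the coordinates of the chamber point of
  \<open>C\<close> in the directions of \<open>D\<close>, so \<open>near\<close> places it in the
  closed cone of \<open>D\<close>. The total \<open>n\<close> exceeds the weight of the proper faces
  on either side by at least 1, which leaves a positive weight for \<open>P\<close> and lets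
  uniqueness of weighted chains apply.\<close>

lemma flag_chamber_eq:
  assumes C: "flag_of C P" and D: "flag_of D P"
    and orth: "\<And>X Y. X \<in> proper D \<Longrightarrow> Y \<in> proper D \<Longrightarrow> Y \<noteq> X \<Longrightarrow> a X \<bullet> (pos Y - center) = 0"
    and pos: "\<And>X. X \<in> proper D \<Longrightarrow> 0 < a X \<bullet> (pos X - center)"
    and span: "flag_point C - center \<in> span ((\<lambda>X. pos X - center) ` proper D)"
    and near: "\<And>X. X \<in> proper D \<Longrightarrow> 0 \<le> a X \<bullet> (flag_point C - center)"
  shows "C = D"
proof -
  let ?v = "\<lambda>X. pos X - center"
  have fin: "finite (proper C)" "finite (proper D)" using finite_flag[OF C] finite_flag[OF D] by auto
  have inj: "inj_on ?v (proper D)"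
    by (rule biorthogonal_independent(2)[of _ a]) (use orth pos in auto)
  obtain u' where "flag_point C - center = (\<Sum>w\<in>?v ` proper D. u' w *\<^sub>R w)"
    using span fin(2) by (auto simp: span_finite)
  then obtain u where u: "flag_point C - center = (\<Sum>X\<in>proper D. u X *\<^sub>R ?v X)"
    by (simp add: sum.reindex[OF inj] that[of "\<lambda>X. u' (?v X)"])
  have u_nonneg: "0 \<le> u X" if X: "X \<in> proper D" for X
  proof -
    have "a X \<bullet> (flag_point C - center) = (\<Sum>Y\<in>proper D. u Y * (a X \<bullet> ?v Y))"
      unfolding u by (simp add: inner_sum_right)
    also have "\<dots> = u X * (a X \<bullet> ?v X)"
      using X fin(2) orth[OF X] by (subst sum.remove[OF fin(2) X]) (simp add: sum.neutral)
    finally show ?thesis using near[OF X] pos[OF X] by (simp add: zero_le_mult_iff)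
  qed
  \<comment> \<open>A priori the point could lie on a wall; faces with coordinate 0 are dropped
    because chain weights must be positive.\<close>
  define D' where "D' = {X \<in> proper D. 0 < u X}"
  have D'f: "finite D'" by (rule finite_subset[OF _ fin(2)]) (auto simp: D'_def)
  have u2: "flag_point C - center = (\<Sum>X\<in>D'. u X *\<^sub>R ?v X)"
    unfolding u using fin(2) u_nonneg by (intro sum.mono_neutral_right) (force simp: D'_def less_le)+
  \<comment> \<open>The cone relation becomes one between points of \<open>P\<close> once \<open>P\<close> itself gets a large weight.\<close>
  define n where "n = 1 + real (card (proper C)) + sum u D'"
  define l where "l X = (if X = P then n - real (card (proper C)) else 1)" for X
  define m where "m X = (if X = P then n - sum u D' else u X)" for X
  have sD: "0 \<le> sum u D'" by (intro sum_nonneg) (auto simp: D'_def)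
  have PC: "P \<notin> proper C" and PD: "P \<notin> D'" by (auto simp: D'_def)
  have lC: "sum l (proper C) = real (card (proper C))" by (simp add: l_def)
  have mD: "sum m D' = sum u D'" using PD by (intro sum.cong) (auto simp: m_def)
  have "P face_of P" by (rule face_of_refl[OF polytope_imp_convex[OF polytope]])
  have sub: "F \<subseteq> P" if "flag_of K P" "F \<in> K" for F K using flag_face[OF that] by (rule face_of_imp_subset)
  have "insert P (proper C) = insert P D'"
  proof (rule weighted_chain_unique[of P pos])
    show "weighted_chain P (insert P (proper C)) l"
      unfolding weighted_chain_def subset_chain_iff
      using fin(1) nonempty \<open>P face_of P\<close> flag_face[OF C] flag_total[OF C] sub[OF C] sD
      by (auto simp: l_def n_def)
    show "weighted_chain P (insert P D') m"
      unfolding weighted_chain_def subset_chain_iff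
      using D'f nonempty \<open>P face_of P\<close> flag_face[OF D] flag_total[OF D] sub[OF D]
      by (auto simp: m_def n_def D'_def)
    show "sum l (insert P (proper C)) = sum m (insert P D')"
      using fin(1) D'f PC PD lC mD by (simp add: l_def[of P] m_def[of P])
    have "(\<Sum>X\<in>insert P (proper C). l X *\<^sub>R pos X) = (n - real (card (proper C))) *\<^sub>R center + (\<Sum>X\<in>proper C. pos X)"
      using fin(1) by (subst sum.insert) (auto simp: l_def intro!: sum.cong)
    also have "\<dots> = n *\<^sub>R center + (\<Sum>X\<in>proper C. ?v X)"
      by (simp add: sum_subtractf sum_constant_scaleR algebra_simps del: sum_constant)
    also have "(\<Sum>X\<in>proper C. ?v X) = flag_point C - center"
      by (simp add: flag_point_def sum_proper[OF C])
    also have "\<dots> = (\<Sum>X\<in>D'. u X *\<^sub>R ?v X)" by (rule u2)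
    also have "n *\<^sub>R center + \<dots> = (n - sum u D') *\<^sub>R center + (\<Sum>X\<in>D'. u X *\<^sub>R pos X)"
      by (simp add: sum_subtractf scaleR_diff_right scaleR_sum_left algebra_simps)
    also have "\<dots> = (\<Sum>X\<in>insert P D'. m X *\<^sub>R pos X)"
      using D'f PD by (subst sum.insert) (auto simp: m_def intro!: sum.cong)
    finally show "(\<Sum>X\<in>insert P (proper C). l X *\<^sub>R pos X) = (\<Sum>X\<in>insert P D'. m X *\<^sub>R pos X)" .
  qed (rule pos_in_rel_interior)
  then have "proper C \<subseteq> D" by (auto simp: D'_def)
  then have CD: "C \<subseteq> D" using empty_in_flag[OF D] polytope_in_flag[OF D] by auto
  have "D \<subseteq> C"
  proof
    fix X assume X: "X \<in> D"
    show "X \<in> C" by (rule flag_maximal[OF C flag_face[OF D X]]) (use CD X flag_total[OF D] in blast)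
  qed
  with CD show ?thesis by blast
qed

end

section \<open>Mirrors of a regular polytope\<close>

locale nonempty_regular_polytope = nonempty_polytope +
  assumes regular: "regular_polytope P"
begin

text \<open>Here flag transitivity enters. The flag is compared with its neighbour across
  \<open>X\<close>, and preservation of dimension forces the symmetry to match the two flags face by
  face.\<close>

lemma flag_wall_symmetry:
  assumes D: "flag_of D P" and X: "X \<in> proper D"
  obtains g where "symmetry_of g P" "g ` X \<noteq> X" "\<forall>Y\<in>D. Y \<noteq> X \<longrightarrow> g ` Y = Y"
proof -
  obtain X' where X': "X' \<noteq> X" "X' \<noteq> {}" "aff_dim X' = aff_dim X" and D': "flag_of (insert X' (D - {X})) P"
    using flag_exchange[OF D, of X] X by blast
  obtain g where g: "symmetry_of g P" "(`) g ` D = insert X' (D - {X})"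
    using regular D D' unfolding regular_polytope_def by blast
  have gD: "g ` Y \<in> insert X' (D - {X})" if "Y \<in> D" for Y
    using imageI[OF that, of "(`) g"] unfolding g(2) .
  have gX: "g ` X = X'"
    by (rule flag_eqI[OF D' gD]) (use X X'(3) in \<open>auto simp: symmetry_aff_dim[OF g(1)]\<close>)
  have gY: "g ` Y = Y" if "Y \<in> D" "Y \<noteq> X" for Y
    by (rule flag_eqI[OF D' gD]) (use that in \<open>auto simp: symmetry_aff_dim[OF g(1)]\<close>)
  show ?thesis by (rule that[OF g(1)]) (use gX gY X'(1) in auto)
qed

lemma flag_wall_normal:
  assumes D: "flag_of D P" and X: "X \<in> proper D"
  obtains a g where "symmetry_of g P" "a \<noteq> 0" "reflect a center (pos X) = g (pos X)"
    "0 < a \<bullet> (pos X - center)"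
    "\<forall>Y\<in>D. Y \<noteq> X \<longrightarrow> a \<bullet> (pos Y - center) = 0 \<and> g (pos Y) = pos Y"
proof -
  obtain g where g: "symmetry_of g P" "g ` X \<noteq> X" "\<forall>Y\<in>D. Y \<noteq> X \<longrightarrow> g ` Y = Y"
    using flag_wall_symmetry[OF D X] .
  have face: "Y face_of P" if "Y \<in> D" for Y using D that by (rule flag_face)
  have fixed: "g (pos Y) = pos Y" if "Y \<in> D" "Y \<noteq> X" for Y
    using g(3) that symmetry_fixes_face_iff[OF g(1) face[OF that(1)]] by simp
  \<comment> \<open>The normal of the perpendicular bisector of \<open>pos X\<close> and its image.
    Points fixed by \<open>g\<close>, among them \<open>center\<close>, are equidistant from both
    and so lie on that bisector.\<close>
  define a where "a = pos X - g (pos X)"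
  have a: "a \<noteq> 0" using symmetry_fixes_face_iff[OF g(1) face[of X]] g(2) X by (auto simp: a_def)
  define x where "x = pos X - center"
  define x' where "x' = g (pos X) - center"
  have ax: "a = x - x'" by (simp add: a_def x_def x'_def)
  have perp: "a \<bullet> (y - center) = 0" if "g y = y" for y
  proof -
    have "dist (g (pos X)) y = dist (pos X) y" "dist (g (pos X)) center = dist (pos X) center"
      using symmetry_dist[OF g(1), of "pos X" y] symmetry_dist[OF g(1), of "pos X" center]
        that symmetry_center[OF g(1)] by simp_all
    then have "(norm (x' - (y - center)))\<^sup>2 = (norm (x - (y - center)))\<^sup>2" "(norm x')\<^sup>2 = (norm x)\<^sup>2"
      by (simp_all add: dist_norm x_def x'_def)
    then show ?thesis
      by (simp add: ax power2_norm_eq_inner inner_diff_left inner_diff_right inner_commute algebra_simps)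
  qed
  have nx: "x \<bullet> x = x' \<bullet> x'"
    using symmetry_dist[OF g(1), of "pos X" center] symmetry_center[OF g(1)]
    by (simp add: dist_norm x_def x'_def norm_eq)
  \<comment> \<open>With this the coefficient in \<open>reflect\<close> becomes 1: reflecting
    \<open>pos X\<close> subtracts exactly \<open>a\<close>.\<close>
  have aa: "a \<bullet> a = 2 * (a \<bullet> x)"
    using nx by (simp add: ax inner_diff_left inner_diff_right inner_commute)
  moreover have "0 < a \<bullet> a" using a by simp
  ultimately have apos: "0 < a \<bullet> x" by simp
  have "reflect a center (pos X) = g (pos X)"
    unfolding reflect_def x_def[symmetric] aa using apos by (simp add: a_def)
  then show ?thesis by (rule that[OF g(1) a]) (use apos perp fixed in \<open>auto simp: x_def\<close>)
qed

text \<open>Biorthogonality to the wall normals makes the directions of the proper faces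
  independent, and by \<open>card_proper\<close> there are as many of them as the dimension of
  \<open>P\<close>.\<close>

lemma flag_span:
  assumes D: "flag_of D P" and x: "x \<in> P"
  shows "x - center \<in> span ((\<lambda>X. pos X - center) ` proper D)"
proof -
  let ?v = "\<lambda>X. pos X - center" and ?T = "(\<lambda>x. x - center) ` P"
  have "\<forall>X\<in>proper D. \<exists>a. 0 < a \<bullet> ?v X \<and> (\<forall>Y\<in>D. Y \<noteq> X \<longrightarrow> a \<bullet> ?v Y = 0)"
  proof
    fix X assume "X \<in> proper D"
    then obtain a g where "0 < a \<bullet> ?v X" "\<forall>Y\<in>D. Y \<noteq> X \<longrightarrow> a \<bullet> ?v Y = 0 \<and> g (pos Y) = pos Y"
      by (rule flag_wall_normal[OF D])
    then show "\<exists>a. 0 < a \<bullet> ?v X \<and> (\<forall>Y\<in>D. Y \<noteq> X \<longrightarrow> a \<bullet> ?v Y = 0)" by blast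
  qed
  from bchoice[OF this] obtain a
    where a: "\<forall>X\<in>proper D. 0 < a X \<bullet> ?v X \<and> (\<forall>Y\<in>D. Y \<noteq> X \<longrightarrow> a X \<bullet> ?v Y = 0)" ..
  have ind: "independent (?v ` proper D)" and inj: "inj_on ?v (proper D)"
    using biorthogonal_independent[of "proper D" a ?v] a by auto
  have "center \<in> P" using pos_in_polytope[of "{}"] by simp
  then have "aff_dim P = int (dim ?T)"
    by (subst aff_dim_eq_dim[of center]) (auto intro: hull_inc simp: image_def)
  then have "dim ?T = card (?v ` proper D)" using card_proper[OF D] card_image[OF inj] by simp
  moreover have "?v ` proper D \<subseteq> ?T" using pos_in_polytope flag_face[OF D] by auto
  ultimately have "?T \<subseteq> span (?v ` proper D)" using ind by (intro card_ge_dim_independent) auto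
  then show ?thesis using x by blast
qed

text \<open>If \<open>P\<close> is not full-dimensional, \<open>g\<close> need not be a reflection
  of the ambient space. On \<open>P\<close> it agrees with one, since both fix \<open>center\<close>
  and the centroids other than \<open>pos X\<close>, and move \<open>pos X\<close> alike.\<close>

lemma flag_reflection:
  assumes D: "flag_of D P" and X: "X \<in> proper D"
  obtains a where "a \<noteq> 0" "symmetry_of (reflect a center) P" "0 < a \<bullet> (pos X - center)"
    "\<forall>Y\<in>D. Y \<noteq> X \<longrightarrow> a \<bullet> (pos Y - center) = 0"
proof -
  obtain a g where g: "symmetry_of g P" and a: "a \<noteq> 0" "reflect a center (pos X) = g (pos X)"
    "0 < a \<bullet> (pos X - center)"
    "\<forall>Y\<in>D. Y \<noteq> X \<longrightarrow> a \<bullet> (pos Y - center) = 0 \<and> g (pos Y) = pos Y"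
    using flag_wall_normal[OF D X] .
  have cc: "reflect a center center = g center"
    by (simp add: reflect_def symmetry_center[OF g])
  have "reflect a center x = g x" if "x \<in> P" for x
  proof (rule reflect_eq_isometry[OF symmetry_dist[OF g] a(1) cc _ flag_span[OF D that]])
    fix b assume "b \<in> (\<lambda>X. pos X - center) ` proper D"
    then obtain Y where Y: "Y \<in> proper D" "b = pos Y - center" by blast
    show "reflect a center (center + b) = g (center + b)"
    proof (cases "Y = X")
      case True then show ?thesis using a(2) Y(2) by simp
    next
      case False then show ?thesis using a(1) bspec[OF a(4), of Y] Y by (simp add: reflect_def)
    qed
  qed
  then have "reflect a center ` P = g ` P" by simp
  then have "symmetry_of (reflect a center) P"
    using g reflect_isometry[OF a(1)] by (simp add: symmetry_of_def)
  then show ?thesis by (rule that[OF a(1) _ a(3)]) (use a(4) in blast)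
qed

lemma separating_reflection:
  assumes C: "flag_of C P" and F0: "F0 \<in> C" "aff_dim F0 = aff_dim F" and G0: "G0 \<in> C" "aff_dim G0 = aff_dim G"
    and F: "F face_of P" and G: "G face_of P" and FG: "F \<subseteq> G" and ne: "(F, G) \<noteq> (F0, G0)"
  obtains a where "a \<noteq> 0" "symmetry_of (reflect a center) P" "0 < a \<bullet> (flag_point C - center)"
    "a \<bullet> (pos F - center) + a \<bullet> (pos G - center) < 0"
proof -
  let ?p = "flag_point C"
  let ?T = "{D. flag_of D P \<and> F \<in> D \<and> G \<in> D}"
  have Tfin: "finite ?T"
    by (rule finite_subset[of _ "Pow {F. F face_of P}"]) (use flag_face finite_faces in auto)
  obtain D0 where "flag_of D0 P" "{F, G} \<subseteq> D0"
    using flag_extension[of "{F, G}"] F G FG by auto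
  then have Tne: "?T \<noteq> {}" by blast
  define D where "D = arg_min_on (\<lambda>D. norm (flag_point D - ?p)) ?T"
  have D: "flag_of D P" "F \<in> D" "G \<in> D"
    and D_min: "\<And>D'. flag_of D' P \<Longrightarrow> F \<in> D' \<Longrightarrow> G \<in> D' \<Longrightarrow> norm (flag_point D - ?p) \<le> norm (flag_point D' - ?p)"
    using arg_min_if_finite[OF Tfin Tne, of "\<lambda>D. norm (flag_point D - ?p)"]
    unfolding D_def[symmetric] by (auto simp: not_less)
  have "D \<noteq> C"
    using ne flag_eqI[OF C F0(1), of F] flag_eqI[OF C G0(1), of G] F0(2) G0(2) D(2,3) by auto
  have "\<forall>X\<in>proper D. \<exists>a. a \<noteq> 0 \<and> symmetry_of (reflect a center) P \<and> 0 < a \<bullet> (pos X - center) \<and>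
    (\<forall>Y\<in>D. Y \<noteq> X \<longrightarrow> a \<bullet> (pos Y - center) = 0)"
  proof
    fix X assume "X \<in> proper D"
    then obtain a where "a \<noteq> 0" "symmetry_of (reflect a center) P" "0 < a \<bullet> (pos X - center)"
      "\<forall>Y\<in>D. Y \<noteq> X \<longrightarrow> a \<bullet> (pos Y - center) = 0"
      by (rule flag_reflection[OF D(1)])
    then show "\<exists>a. a \<noteq> 0 \<and> symmetry_of (reflect a center) P \<and> 0 < a \<bullet> (pos X - center) \<and>
      (\<forall>Y\<in>D. Y \<noteq> X \<longrightarrow> a \<bullet> (pos Y - center) = 0)" by blast
  qed
  from bchoice[OF this] obtain a where a: "\<forall>X\<in>proper D. a X \<noteq> 0 \<and>
    symmetry_of (reflect (a X) center) P \<and> 0 < a X \<bullet> (pos X - center) \<and>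
    (\<forall>Y\<in>D. Y \<noteq> X \<longrightarrow> a X \<bullet> (pos Y - center) = 0)" ..
  have "?p - center = (\<Sum>X\<in>C. pos X - center)" by (simp add: flag_point_def)
  also have "\<dots> \<in> span ((\<lambda>X. pos X - center) ` proper D)"
    by (intro span_sum flag_span[OF D(1)] pos_in_polytope flag_face[OF C])
  finally have span: "?p - center \<in> span ((\<lambda>X. pos X - center) ` proper D)" .
  have "\<exists>X\<in>proper D. a X \<bullet> (?p - center) < 0"
  proof (rule ccontr)
    assume "\<not> ?thesis"
    then have "C = D" using a by (intro flag_chamber_eq[OF C D(1) _ _ span, of a]) (auto simp: not_less)
    with \<open>D \<noteq> C\<close> show False by simp
  qed
  then obtain X where X: "X \<in> proper D" "a X \<bullet> (?p - center) < 0" by blast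
  define b where "b = a X"
  have b: "b \<noteq> 0" "symmetry_of (reflect b center) P" "0 < b \<bullet> (pos X - center)"
    "\<And>Y. Y \<in> D \<Longrightarrow> Y \<noteq> X \<Longrightarrow> b \<bullet> (pos Y - center) = 0" "b \<bullet> (?p - center) < 0"
    using bspec[OF a X(1)] X(2) by (auto simp: b_def)
  have "X = F \<or> X = G"
  proof (rule ccontr)
    assume "\<not> ?thesis"
    then have "b \<bullet> (pos F - center) = 0" "b \<bullet> (pos G - center) = 0" using b(4) D by auto
    then have fx: "reflect b center ` F = F" "reflect b center ` G = G"
      using b(1) by (simp_all add: symmetry_fixes_face_iff[OF b(2)] F G reflect_fixed_iff)
    have "F \<in> (`) (reflect b center) ` D" "G \<in> (`) (reflect b center) ` D"
      using imageI[OF D(2), of "(`) (reflect b center)"] imageI[OF D(3), of "(`) (reflect b center)"]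
      unfolding fx .
    then have "norm (flag_point D - ?p) \<le> norm (reflect b center (flag_point D) - ?p)"
      using D_min[OF flag_symmetry_image[OF b(2) D(1)]] flag_point_symmetry_image[OF b(2) D(1)] by simp
    then have "(norm (flag_point D - ?p))\<^sup>2 \<le> (norm (reflect b center (flag_point D) - ?p))\<^sup>2" by simp
    \<comment> \<open>All members of \<open>D\<close> other than \<open>X\<close> lie on the wall,
      so the chamber point of \<open>D\<close> has the height of \<open>pos X\<close>, on the side
      opposite to \<open>?p\<close>.\<close>
    moreover have "b \<bullet> (flag_point D - center) = (\<Sum>Y\<in>D. b \<bullet> (pos Y - center))"
      by (simp add: flag_point_def inner_sum_right)
    moreover have "\<dots> = b \<bullet> (pos X - center)"
      using X(1) finite_flag[OF D(1)] b(4) by (subst sum.remove[of D X]) (auto simp: sum.neutral)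
    ultimately have "0 \<le> (b \<bullet> (pos X - center)) * (b \<bullet> (?p - center)) / (b \<bullet> b)"
      unfolding norm_reflect_diff[OF b(1)] by simp
    moreover have "(b \<bullet> (pos X - center)) * (b \<bullet> (?p - center)) / (b \<bullet> b) < 0"
      using b by (intro divide_neg_pos mult_pos_neg) auto
    ultimately show False by simp
  qed
  \<comment> \<open>The end of the edge equal to \<open>X\<close> is strictly on the positive side;
    the other end lies on the wall, unless \<open>F = G\<close>.\<close>
  then have "0 < b \<bullet> (pos F - center) + b \<bullet> (pos G - center)"
    using b(3) b(4)[OF D(2)] b(4)[OF D(3)] by (cases "X = F"; cases "X = G") auto
  \<comment> \<open>Changing the sign of the normal keeps the mirror and puts the base point on the
    positive side.\<close>
  moreover have "reflect (- b) center = reflect b center" by (simp add: reflect_def fun_eq_iff)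
  ultimately show ?thesis using b by (intro that[of "- b"]) auto
qed

end

lemma (in nonempty_regular_polytope) percolating_incidence_graph:
  assumes k: "-1 \<le> k" and kr: "k \<le> r" and r: "r \<le> aff_dim P"
  shows "\<exists>e. percolating (faces_of_dim k P) (faces_of_dim r P) (incidence_edges k r P) e"
proof -
  let ?A = "faces_of_dim k P" and ?B = "faces_of_dim r P" and ?E = "incidence_edges k r P"
  \<comment> \<open>As \<open>k \<le> r\<close>, the inclusion \<open>G \<subseteq> F\<close> is
    possible only for \<open>F = G\<close>, so one direction of containment remains.\<close>
  have E: "(F, G) \<in> ?E \<longleftrightarrow> F face_of P \<and> aff_dim F = k \<and> G face_of P \<and> aff_dim G = r \<and> F \<subseteq> G" for F G
    using kr comparable_faces_aff_dim[of F G] by (auto simp: incidence_edges_def faces_of_dim_def)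
  obtain C where C: "flag_of C P" using flag_extension[of "{}"] by auto
  obtain F0 where F0: "F0 \<in> C" "aff_dim F0 = k" using flag_has_dim[OF C k] kr r by auto
  obtain G0 where G0: "G0 \<in> C" "aff_dim G0 = r" using flag_has_dim[OF C _ r] k kr by auto
  have "F0 \<subseteq> G0" using flag_subsetI[OF C F0(1) G0(1)] F0(2) G0(2) kr by simp
  then have e0: "(F0, G0) \<in> ?E" using E F0 G0 flag_face[OF C] by blast
  let ?p = "flag_point C"
  let ?mid = "\<lambda>F G. (1/2) *\<^sub>R (pos F + pos G)"
  \<comment> \<open>\<open>\<sigma> F + \<tau> G\<close> is twice the signed height of the midpoint
    over the mirror. An edge on the negative side thus has its midpoint separated from
    \<open>?p\<close>, and reflecting brings it closer, whichever mirror is used.\<close>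
  define rank where "rank = (\<lambda>(F, G). (norm (?mid F G - ?p))\<^sup>2)"
  have "\<exists>\<phi> \<psi> \<sigma> \<tau>. cut_involution ?A ?B ?E \<phi> \<psi> \<sigma> \<tau> \<and> \<sigma> F + \<tau> G < 0 \<and>
      (\<forall>(F', G')\<in>?E. \<sigma> F' + \<tau> G' < 0 \<longrightarrow> rank (\<phi> F', \<psi> G') < rank (F', G'))"
    if FG: "(F, G) \<in> ?E" "(F, G) \<noteq> (F0, G0)" for F G
  proof -
    have FG': "F face_of P" "aff_dim F = k" "G face_of P" "aff_dim G = r" "F \<subseteq> G"
      using FG(1) by (simp_all add: E)
    obtain a where a: "a \<noteq> 0" and s: "symmetry_of (reflect a center) P"
      and ap: "0 < a \<bullet> (?p - center)" and far: "a \<bullet> (pos F - center) + a \<bullet> (pos G - center) < 0"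
      by (rule separating_reflection[OF C F0(1) _ G0(1) _ FG'(1,3,5) FG(2)])
        (use F0(2) G0(2) FG'(2,4) in auto)
    let ?\<rho> = "reflect a center"
    let ?\<sigma> = "\<lambda>F. a \<bullet> (pos F - center)"
    have face: "?\<rho> ` X face_of P" "aff_dim (?\<rho> ` X) = aff_dim X" "?\<rho> ` ?\<rho> ` X = X"
      "?\<sigma> (?\<rho> ` X) = - ?\<sigma> X" "?\<sigma> X = 0 \<longrightarrow> ?\<rho> ` X = X" if "X face_of P" for X
      using that a by (simp_all add: symmetry_face[OF s] symmetry_aff_dim[OF s] image_image
          symmetry_pos[OF s] reflect_inner symmetry_fixes_face_iff[OF s] reflect_fixed_iff)
    have cut: "cut_involution ?A ?B ?E ((`) ?\<rho>) ((`) ?\<rho>) ?\<sigma> ?\<sigma>"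
      unfolding cut_involution_def
    proof (intro conjI ballI)
      fix e assume e: "e \<in> ?E"
      show "case e of (F, G) \<Rightarrow> (?\<rho> ` F, ?\<rho> ` G) \<in> ?E \<and> 0 \<le> ?\<sigma> F * ?\<sigma> G"
      proof (cases e)
        case (Pair X Y)
        with e have XY: "X face_of P" "aff_dim X = k" "Y face_of P" "aff_dim Y = r" "X \<subseteq> Y"
          by (simp_all add: E)
        then have "(?\<rho> ` X, ?\<rho> ` Y) \<in> ?E" by (simp add: E face image_mono)
        then show ?thesis using reflect_symmetry_cut[OF a s XY(1,3,5)] by (simp add: Pair)
      qed
    qed (use face in \<open>auto simp: faces_of_dim_def\<close>)
    have "rank (?\<rho> ` X, ?\<rho> ` Y) < rank (X, Y)" if XY: "(X, Y) \<in> ?E" "?\<sigma> X + ?\<sigma> Y < 0" for X Y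
    proof -
      have "X face_of P" "Y face_of P" using XY(1) by (simp_all add: E)
      then have "?mid (?\<rho> ` X) (?\<rho> ` Y) = (1/2) *\<^sub>R (?\<rho> (pos X) + ?\<rho> (pos Y))"
        by (simp add: symmetry_pos[OF s])
      also have "\<dots> = ?\<rho> (?mid X Y)"
        by (rule reflect_midpoint[symmetric])
      finally have mid: "?mid (?\<rho> ` X) (?\<rho> ` Y) = ?\<rho> (?mid X Y)" .
      have "a \<bullet> (?mid X Y - center) = (?\<sigma> X + ?\<sigma> Y) / 2"
        by (simp add: inner_diff_right inner_add_right field_simps)
      then have "a \<bullet> (?mid X Y - center) < 0" using XY(2) by simp
      then have "4 * (a \<bullet> (?mid X Y - center)) < 0" by simp
      then have "4 * (a \<bullet> (?mid X Y - center)) * (a \<bullet> (?p - center)) / (a \<bullet> a) < 0"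
        using a by (intro divide_neg_pos mult_neg_pos[OF _ ap]) auto
      then show ?thesis unfolding rank_def by (simp only: prod.case mid norm_reflect_diff[OF a])
    qed
    then show ?thesis using cut far by blast
  qed
  moreover have "finite ?A" "finite ?B"
    using finite_faces by (auto simp: faces_of_dim_def intro: rev_finite_subset)
  moreover have "?E \<subseteq> ?A \<times> ?B" by (auto simp: incidence_edges_def)
  ultimately have "percolating ?A ?B ?E (F0, G0)"
    unfolding percolating_def using e0 by blast
  then show ?thesis ..
qed

text \<open>The empty polytope has no centre and stays outside the locale. Its only face gives a
  single edge, for which nothing has to be folded.\<close>

lemma percolating_incidence_graph_empty:
  "percolating (faces_of_dim (-1) {}) (faces_of_dim (-1) {}) (incidence_edges (-1) (-1) ({} :: 'a::euclidean_space set)) ({}, {})"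
proof -
  have f: "faces_of_dim (-1) ({} :: 'a set) = {{}}" by (auto simp: faces_of_dim_def)
  then have "incidence_edges (-1) (-1) ({} :: 'a set) = {({}, {})}" by (auto simp: incidence_edges_def)
  with f show ?thesis by (simp add: percolating_def)
qed

text \<open>Improper faces count, so dimensions run from -1 to \<open>aff_dim P\<close>. Outside
  this range a vertex class is empty and the graph has no edge from which a norm could be
  formed.\<close>

theorem theorem1p1:
  fixes P :: "'a::euclidean_space set" and k r :: int
  assumes "regular_polytope P"
    and "-1 \<le> k" and "k \<le> r" and "r \<le> aff_dim P"
  shows "weakly_norming (faces_of_dim k P) (faces_of_dim r P) (incidence_edges k r P)"
proof (cases "P = {}")
  case True
  then have "k = -1" "r = -1" using assms by auto
  then show ?thesis using percolating_weakly_norming[OF percolating_incidence_graph_empty] True by simp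
next
  case False
  then interpret nonempty_regular_polytope P
    using assms(1) by unfold_locales (auto simp: regular_polytope_def)
  show ?thesis
    using percolating_incidence_graph[OF assms(2-4)] percolating_weakly_norming by blast
qed

end
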